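(* Let $c:\mathrm{cl}(M\times\bar M)\to\mathbf{R}\cup\{+\infty\}$ be a cost whose restriction to a domain $N\subset M\times\bar M$ is of class $C^4(N)$ and non-degenerate, and use it to define the pseudo-metric $h$ on $N$; assume $N$ is horizontally convex. Fix $\Omega\subset\mathrm{cl}\,M$, $x\in M$, and a set $\bar\Omega\subset\mathrm{cl}\,\bar N(x)$ which appears convex from $x$. Suppose $\bigcap_{0\le t\le1}N(\bar x(t))$ is dense in $\Omega$ for each geodesic $t\in[0,1]\mapsto(x,\bar x(t))\in\{x\}\times\bar\Omega$, and that $c:\mathrm{cl}(N)\to\mathbf{R}\cup\{+\infty\}$ is continuous. If $c$ is weakly regular on $N$, then for each $u:\Omega\to\mathbf{R}\cup\{+\infty\}$ with $x\in\operatorname{Dom}u:=\{y\in\Omega\mid u(y)<+\infty\}$, the set $\bar\Omega\cap\partial^c_\Omega u(x)$ is connected, and in fact appears convex from $x$.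
   Context: **Setting.** $M,\bar M$ are smooth $n$-dimensional manifolds which, if not compact, are continuously embedded in separable metrizable spaces in which their closures $\mathrm{cl}\,M$, $\mathrm{cl}\,\bar M$ are compact. The cost $c:\mathrm{cl}(M\times\bar M)\to\mathbf{R}\cup\{+\infty\}$ is lower semicontinuous and $N\subset M\times\bar M$ is a (open) subdomain. Put $\bar N(x)=\{\bar x\in\bar M\mid(x,\bar x)\in N\}$ and $N(\bar x)=\{x\in M\mid(x,\bar x)\in N\}$. **Pseudo-metric.** In local coordinates $x^1,\dots,x^n$ on $M$ and $x^{\bar1},\dots,x^{\bar n}$ on $\bar M$, subscripts on $c$ denote partial derivatives, e.g. $c_{i\bar j}=\partial^2c/\partial x^i\partial x^{\bar j}$. The cost $c\in C^2(N)$ is non-degenerate if the matrix $(c_{i\bar j}(x,\bar x))$ (equivalently the linear map $\bar DDc:T_{\bar x}\bar M\to T_x^*M$) is invertible at every $(x,\bar x)\in N$; its inverse is written $c^{\bar jk}$. Then $h=\frac12\begin{pmatrix}0&-\bar DDc\\-D\bar Dc&0\end{pmatrix}$ on $T_{(x,\bar x)}N=T_xM\oplus T_{\bar x}\bar M$, i.e. $h(p\oplus\bar p,p\oplus\bar p)=-c_{i\bar j}p^ip^{\bar j}$, is a pseudo-Riemannian metric on $N$. A vector $p\oplus\bar p$ is null if $h(p\oplus\bar p,p\oplus\bar p)=0$. Geodesics are curves satisfying the geodesic equation of $(N,h)$. **Curvature and weak regularity.** For $P,Q\in T_{(x,\bar x)}N$ the (unnormalized) sectional curvature is $\sec_{(x,\bar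 x)}P\wedge Q=\sum R_{i'j'k'l'}P^{i'}Q^{j'}P^{k'}Q^{l'}$ (indices running over all $2n$ coordinates of $N$), where $R$ is the Riemann tensor of $h$ with the sign convention $R_{i'j'k'}{}^{m'}=-\partial_{i'}\Gamma^{m'}_{j'k'}+\partial_{j'}\Gamma^{m'}_{i'k'}+\Gamma^{f'}_{k'i'}\Gamma^{m'}_{j'f'}-\Gamma^{f'}_{k'j'}\Gamma^{m'}_{i'f'}$, last index lowered with $h$. The cost $c\in C^4(N)$ is weakly regular on $N$ if it is non-degenerate and $\sec_{(x,\bar x)}(p\oplus0)\wedge(0\oplus\bar p)\ge0$ for every $(x,\bar x)\in N$ and all null vectors $p\oplus\bar p\in T_{(x,\bar x)}N$. **Convexity.** A subset $W\subset N$ is geodesically convex if each pair of points of $W$ is linked by a curve in $W$ satisfying the geodesic equation on $(N,h)$; for $W\subset\mathrm{cl}\,N$ the definition is extended by allowing geodesics in $N$ which have endpoints on $\partial N$. A set $\bar\Omega\subset\mathrm{cl}\,\bar M$ appears convex from $x\in M$ if $\{x\}\times\bar\Omega$ is geodesically convex and $\bar\Omega\subset\mathrm{cl}\,\bar N(x)$. A set $\Omega\subset\mathrm{cl}\,M$ appears convex from $\bar x\in\bar M$ if $\Omega\times\{\bar x\}$ is geodesically convex and $\Omega\subset\mathrm{cl}\,N(\bar x)$. $N$ is horizontally convex if $N(\bar x)$ appears convex from $\bar x$ for each $\bar x\in\bar M$. **Contact set.** $\operatorname{Dom}c=\{(x,\bar x)\in\mathrm{cl}(M\times\bar M)\mid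 c(x,\bar x)<\infty\}$. For $u:\Omega\to\mathbf{R}\cup\{+\infty\}$, $\partial^c_\Omega u=\{(x,\bar x)\in\operatorname{Dom}c\mid u(y)+c(y,\bar x)\ge u(x)+c(x,\bar x)\ \text{for all }y\in\Omega\}$ and $\partial^c_\Omega u(x)=\{\bar x\in\mathrm{cl}\,\bar M\mid(x,\bar x)\in\partial^c_\Omega u\}$. *)

theory Defs
  imports "HOL-Analysis.Analysis"
begin

section \<open>Functions of class \<open>C\<^sup>k\<close>, smooth manifolds\<close>

text \<open>Intended for open \<open>S\<close>.\<close>

primrec Ck_on :: "nat \<Rightarrow> ('a::euclidean_space \<Rightarrow> 'b::real_normed_vector) \<Rightarrow> 'a set \<Rightarrow> bool" where
  "Ck_on 0 f S \<longleftrightarrow> continuous_on S f"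
| "Ck_on (Suc k) f S \<longleftrightarrow> (\<forall>x\<in>S. f differentiable (at x)) \<and>
     (\<forall>b\<in>Basis. Ck_on k (\<lambda>x. frechet_derivative f (at x) b) S)"

definition smooth_on :: "'a::euclidean_space set \<Rightarrow> ('a \<Rightarrow> 'b::real_normed_vector) \<Rightarrow> bool" where
  "smooth_on S f \<longleftrightarrow> (\<forall>k. Ck_on k f S)"

text \<open>
  The manifold \<open>M\<close> is a subset of a space carrying the ambient topology, in which closures are
  taken; its manifold topology is the subspace topology. The smooth structure is given by an
  atlas, a set of pairs of a chart domain and a coordinate map into \<open>real^'n\<close>.
\<close>

definition smooth_atlas ::
    "'a::topological_space set \<Rightarrow> ('a set \<times> ('a \<Rightarrow> real^'n)) set \<Rightarrow> bool" where
  "smooth_atlas M A \<longleftrightarrow>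
     M = (\<Union>(U, \<phi>)\<in>A. U) \<and>
     (\<forall>(U, \<phi>)\<in>A. openin (top_of_set M) U \<and> open (\<phi> ` U) \<and>
        homeomorphism U (\<phi> ` U) \<phi> (inv_into U \<phi>)) \<and>
     (\<forall>(U, \<phi>)\<in>A. \<forall>(V, \<psi>)\<in>A. smooth_on (\<phi> ` (U \<inter> V)) (\<lambda>z. \<psi> (inv_into U \<phi> z)))"

definition lower_semicontinuous_on :: "'a::topological_space set \<Rightarrow> ('a \<Rightarrow> ereal) \<Rightarrow> bool" where
  "lower_semicontinuous_on S f \<longleftrightarrow> (\<forall>z\<in>S. f z \<le> Liminf (at z within S) f)"


section \<open>Pseudo-Riemannian geometry in coordinates\<close>

definition partial :: "'m::finite \<Rightarrow> (real^'m \<Rightarrow> real) \<Rightarrow> real^'m \<Rightarrow> real" where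
  "partial i f z = frechet_derivative f (at z) (axis i 1)"

text \<open>\<open>christoffel g m i j z\<close> is \<open>\<Gamma>\<^sup>m\<^sub>i\<^sub>j\<close> of the Levi-Civita connection of \<open>g\<close> at \<open>z\<close>.\<close>

definition christoffel ::
    "(real^'m \<Rightarrow> real^'m^'m) \<Rightarrow> 'm::finite \<Rightarrow> 'm \<Rightarrow> 'm \<Rightarrow> real^'m \<Rightarrow> real" where
  "christoffel g m i j z =
     (\<Sum>l\<in>UNIV. matrix_inv (g z) $ m $ l *
        (partial i (\<lambda>y. g y $ j $ l) z + partial j (\<lambda>y. g y $ i $ l) z
          - partial l (\<lambda>y. g y $ i $ j) z)) / 2"

text \<open>
  Sign convention: \<open>riemann g i j k m z\<close>, with \<open>m\<close> the raised index, is the negative of the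
  coefficient of \<open>\<partial>\<^sub>m\<close> in
  \<open>\<nabla>\<^sub>i \<nabla>\<^sub>j \<partial>\<^sub>k - \<nabla>\<^sub>j \<nabla>\<^sub>i \<partial>\<^sub>k\<close>, so that round spheres have positive sectional curvature below.
\<close>

definition riemann ::
    "(real^'m \<Rightarrow> real^'m^'m) \<Rightarrow> 'm::finite \<Rightarrow> 'm \<Rightarrow> 'm \<Rightarrow> 'm \<Rightarrow> real^'m \<Rightarrow> real" where
  "riemann g i j k m z =
     - partial i (christoffel g m j k) z + partial j (christoffel g m i k) z
     + (\<Sum>f\<in>UNIV. christoffel g f k i z * christoffel g m j f z)
     - (\<Sum>f\<in>UNIV. christoffel g f k j z * christoffel g m i f z)"

definition riemann_lowered ::
    "(real^'m \<Rightarrow> real^'m^'m) \<Rightarrow> 'm::finite \<Rightarrow> 'm \<Rightarrow> 'm \<Rightarrow> 'm \<Rightarrow> real^'m \<Rightarrow> real" where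
  "riemann_lowered g i j k l z = (\<Sum>m\<in>UNIV. riemann g i j k m z * g z $ m $ l)"

definition sec ::
    "(real^'m \<Rightarrow> real^'m^'m) \<Rightarrow> real^'m::finite \<Rightarrow> real^'m \<Rightarrow> real^'m \<Rightarrow> real" where
  "sec g z P Q =
     (\<Sum>i\<in>UNIV. \<Sum>j\<in>UNIV. \<Sum>k\<in>UNIV. \<Sum>l\<in>UNIV.
        riemann_lowered g i j k l z * P $ i * Q $ j * P $ k * Q $ l)"

text \<open>
  The geodesic equation at parameter \<open>t\<close> for a curve \<open>\<zeta>\<close> in coordinates with parameters in
  \<open>[0,1]\<close>; \<open>v\<close> is its velocity near \<open>t\<close>, and derivatives at \<open>0\<close> and \<open>1\<close> are one-sided.
\<close>

definition geodesic_equation_at ::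
    "(real^'m \<Rightarrow> real^'m^'m) \<Rightarrow> (real \<Rightarrow> real^'m::finite) \<Rightarrow> real \<Rightarrow> bool" where
  "geodesic_equation_at g \<zeta> t \<longleftrightarrow>
     (\<exists>v. (\<forall>\<^sub>F s in nhds t. s \<in> {0..1} \<longrightarrow> (\<zeta> has_vector_derivative v s) (at s within {0..1})) \<and>
          (v has_vector_derivative
             (\<chi> m. - (\<Sum>i\<in>UNIV. \<Sum>j\<in>UNIV. christoffel g m i j (\<zeta> t) * v t $ i * v t $ j)))
            (at t within {0..1}))"


section \<open>The pseudo-metric of a cost\<close>

text \<open>
  Coordinates on \<open>M \<times> M'\<close> are indexed by the sum type \<open>'n + 'n\<close>: \<open>Inl i\<close> is the unbarred
  index \<open>i\<close> and \<open>Inr j\<close> the barred one. \<open>oplus\<close> joins both coordinate tuples and, for tangent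
  vectors given by their components, both summands of \<open>T\<^sub>x M \<oplus> T\<^sub>x\<^sub>' M'\<close>.
\<close>

definition oplus :: "real^'n \<Rightarrow> real^'n \<Rightarrow> real^('n + 'n)" (infixr "\<oplus>\<^sub>v" 65) where
  "p \<oplus>\<^sub>v p' = (\<chi> k. case k of Inl i \<Rightarrow> p $ i | Inr j \<Rightarrow> p' $ j)"

definition chart_image ::
    "('a \<times> 'b) set \<Rightarrow> 'a set \<Rightarrow> ('a \<Rightarrow> real^'n) \<Rightarrow> 'b set \<Rightarrow> ('b \<Rightarrow> real^'n) \<Rightarrow> (real^('n + 'n)) set"
  where
  "chart_image N U \<phi> V \<psi> = (\<lambda>(x, y). \<phi> x \<oplus>\<^sub>v \<psi> y) ` (N \<inter> U \<times> V)"

definition local_cost ::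
    "('a \<times> 'b \<Rightarrow> ereal) \<Rightarrow> 'a set \<Rightarrow> ('a \<Rightarrow> real^'n) \<Rightarrow> 'b set \<Rightarrow> ('b \<Rightarrow> real^'n)
       \<Rightarrow> real^('n + 'n) \<Rightarrow> real" where
  "local_cost c U \<phi> V \<psi> z =
     real_of_ereal (c (inv_into U \<phi> (\<chi> i. z $ Inl i), inv_into V \<psi> (\<chi> j. z $ Inr j)))"

text \<open>The matrix \<open>c\<^sub>i\<^sub>j\<close> of mixed second derivatives (\<open>j\<close> barred).\<close>

definition cross_matrix ::
    "('a \<times> 'b \<Rightarrow> ereal) \<Rightarrow> 'a set \<Rightarrow> ('a \<Rightarrow> real^'n) \<Rightarrow> 'b set \<Rightarrow> ('b \<Rightarrow> real^'n)
       \<Rightarrow> real^('n + 'n) \<Rightarrow> real^'n^'n" where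
  "cross_matrix c U \<phi> V \<psi> z =
     (\<chi> i j. partial (Inl i) (partial (Inr j) (local_cost c U \<phi> V \<psi>)) z)"

definition cost_metric ::
    "('a \<times> 'b \<Rightarrow> ereal) \<Rightarrow> 'a set \<Rightarrow> ('a \<Rightarrow> real^'n) \<Rightarrow> 'b set \<Rightarrow> ('b \<Rightarrow> real^'n)
       \<Rightarrow> real^('n + 'n) \<Rightarrow> real^('n + 'n)^('n + 'n)" where
  "cost_metric c U \<phi> V \<psi> z =
     (\<chi> k l. case (k, l) of
        (Inl i, Inr j) \<Rightarrow> - cross_matrix c U \<phi> V \<psi> z $ i $ j / 2
      | (Inr j, Inl i) \<Rightarrow> - cross_matrix c U \<phi> V \<psi> z $ i $ j / 2
      | _ \<Rightarrow> 0)"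

definition cost_Ck ::
    "nat \<Rightarrow> ('a set \<times> ('a \<Rightarrow> real^'n)) set \<Rightarrow> ('b set \<times> ('b \<Rightarrow> real^'n)) set
       \<Rightarrow> ('a \<times> 'b) set \<Rightarrow> ('a \<times> 'b \<Rightarrow> ereal) \<Rightarrow> bool" where
  "cost_Ck k A A' N c \<longleftrightarrow>
     (\<forall>z\<in>N. \<bar>c z\<bar> \<noteq> \<infinity>) \<and>
     (\<forall>(U, \<phi>)\<in>A. \<forall>(V, \<psi>)\<in>A'. Ck_on k (local_cost c U \<phi> V \<psi>) (chart_image N U \<phi> V \<psi>))"

definition nondegenerate ::
    "('a set \<times> ('a \<Rightarrow> real^'n)) set \<Rightarrow> ('b set \<times> ('b \<Rightarrow> real^'n)) set
       \<Rightarrow> ('a \<times> 'b) set \<Rightarrow> ('a \<times> 'b \<Rightarrow> ereal) \<Rightarrow> bool" where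
  "nondegenerate A A' N c \<longleftrightarrow>
     (\<forall>(U, \<phi>)\<in>A. \<forall>(V, \<psi>)\<in>A'. \<forall>z\<in>chart_image N U \<phi> V \<psi>. invertible (cross_matrix c U \<phi> V \<psi> z))"

definition null_vector :: "real^'m^'m \<Rightarrow> real^'m::finite \<Rightarrow> bool" where
  "null_vector h P \<longleftrightarrow> P \<bullet> (h *v P) = 0"

definition weakly_regular ::
    "('a set \<times> ('a \<Rightarrow> real^'n)) set \<Rightarrow> ('b set \<times> ('b \<Rightarrow> real^'n)) set
       \<Rightarrow> ('a \<times> 'b) set \<Rightarrow> ('a \<times> 'b \<Rightarrow> ereal) \<Rightarrow> bool" where
  "weakly_regular A A' N c \<longleftrightarrow>
     cost_Ck 4 A A' N c \<and> nondegenerate A A' N c \<and>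
     (\<forall>(U, \<phi>)\<in>A. \<forall>(V, \<psi>)\<in>A'. \<forall>z\<in>chart_image N U \<phi> V \<psi>. \<forall>p p'.
        null_vector (cost_metric c U \<phi> V \<psi> z) (p \<oplus>\<^sub>v p') \<longrightarrow>
        sec (cost_metric c U \<phi> V \<psi>) z (p \<oplus>\<^sub>v 0) (0 \<oplus>\<^sub>v p') \<ge> 0)"


section \<open>Geodesics and convexity\<close>

text \<open>
  Geodesics in \<open>N\<close> parametrized by \<open>[0,1]\<close>, whose endpoints may lie on the boundary of \<open>N\<close>; by
  continuity the endpoints are always in \<open>closure N\<close>. The geodesic equation is required wherever
  the curve is in \<open>N\<close>, in particular at an endpoint in \<open>N\<close>.
\<close>

definition geodesic ::
    "('a::topological_space set \<times> ('a \<Rightarrow> real^'n)) set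
       \<Rightarrow> ('b::topological_space set \<times> ('b \<Rightarrow> real^'n)) set
       \<Rightarrow> ('a \<times> 'b) set \<Rightarrow> ('a \<times> 'b \<Rightarrow> ereal) \<Rightarrow> (real \<Rightarrow> 'a \<times> 'b) \<Rightarrow> bool" where
  "geodesic A A' N c \<gamma> \<longleftrightarrow>
     path \<gamma> \<and> (\<forall>t\<in>{0<..<1}. \<gamma> t \<in> N) \<and>
     (\<forall>t\<in>{0..1}. \<gamma> t \<in> N \<longrightarrow>
        (\<forall>(U, \<phi>)\<in>A. \<forall>(V, \<psi>)\<in>A'. \<gamma> t \<in> U \<times> V \<longrightarrow>
           geodesic_equation_at (cost_metric c U \<phi> V \<psi>)
             (\<lambda>s. \<phi> (fst (\<gamma> s)) \<oplus>\<^sub>v \<psi> (snd (\<gamma> s))) t))"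

text \<open>
  Pairs of equal points are exempt: for a point of \<open>N\<close> the constant geodesic is available anyway,
  and a boundary point of \<open>N\<close> is trivially linked to itself although the constant curve there is
  not a geodesic in \<open>N\<close>.
\<close>

definition geodesically_convex ::
    "('a::topological_space set \<times> ('a \<Rightarrow> real^'n)) set
       \<Rightarrow> ('b::topological_space set \<times> ('b \<Rightarrow> real^'n)) set
       \<Rightarrow> ('a \<times> 'b) set \<Rightarrow> ('a \<times> 'b \<Rightarrow> ereal) \<Rightarrow> ('a \<times> 'b) set \<Rightarrow> bool" where
  "geodesically_convex A A' N c W \<longleftrightarrow>
     W \<subseteq> closure N \<and>
     (\<forall>z\<in>W. \<forall>w\<in>W. z \<noteq> w \<longrightarrow>
        (\<exists>\<gamma>. geodesic A A' N c \<gamma> \<and> pathstart \<gamma> = z \<and> pathfinish \<gamma> = w \<and> path_image \<gamma> \<subseteq> W))"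

text \<open>\<open>section_right N x\<close> is the set of \<open>y\<close> with \<open>(x, y) \<in> N\<close>, \<open>section_left N y\<close> that of \<open>x\<close>.\<close>

definition section_right :: "('a \<times> 'b) set \<Rightarrow> 'a \<Rightarrow> 'b set" where
  "section_right N x = {y. (x, y) \<in> N}"

definition section_left :: "('a \<times> 'b) set \<Rightarrow> 'b \<Rightarrow> 'a set" where
  "section_left N y = {x. (x, y) \<in> N}"

definition appears_convex_right ::
    "('a::topological_space set \<times> ('a \<Rightarrow> real^'n)) set
       \<Rightarrow> ('b::topological_space set \<times> ('b \<Rightarrow> real^'n)) set
       \<Rightarrow> ('a \<times> 'b) set \<Rightarrow> ('a \<times> 'b \<Rightarrow> ereal) \<Rightarrow> 'b set \<Rightarrow> 'a \<Rightarrow> bool" where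
  "appears_convex_right A A' N c \<Omega>' x \<longleftrightarrow>
     geodesically_convex A A' N c ({x} \<times> \<Omega>') \<and> \<Omega>' \<subseteq> closure (section_right N x)"

definition appears_convex_left ::
    "('a::topological_space set \<times> ('a \<Rightarrow> real^'n)) set
       \<Rightarrow> ('b::topological_space set \<times> ('b \<Rightarrow> real^'n)) set
       \<Rightarrow> ('a \<times> 'b) set \<Rightarrow> ('a \<times> 'b \<Rightarrow> ereal) \<Rightarrow> 'a set \<Rightarrow> 'b \<Rightarrow> bool" where
  "appears_convex_left A A' N c \<Omega> y \<longleftrightarrow>
     geodesically_convex A A' N c (\<Omega> \<times> {y}) \<and> \<Omega> \<subseteq> closure (section_left N y)"

definition horizontally_convex ::
    "('a::topological_space set \<times> ('a \<Rightarrow> real^'n)) set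
       \<Rightarrow> 'b::topological_space set \<Rightarrow> ('b set \<times> ('b \<Rightarrow> real^'n)) set
       \<Rightarrow> ('a \<times> 'b) set \<Rightarrow> ('a \<times> 'b \<Rightarrow> ereal) \<Rightarrow> bool" where
  "horizontally_convex A M' A' N c \<longleftrightarrow>
     (\<forall>y\<in>M'. appears_convex_left A A' N c (section_left N y) y)"


section \<open>The contact set\<close>

definition Dom_cost ::
    "'a::topological_space set \<Rightarrow> 'b::topological_space set \<Rightarrow> ('a \<times> 'b \<Rightarrow> ereal)
       \<Rightarrow> ('a \<times> 'b) set" where
  "Dom_cost M M' c = {z \<in> closure (M \<times> M'). c z < \<infinity>}"

text \<open>\<open>u\<close> is only meaningful on \<open>\<Omega>\<close>, hence the condition \<open>x \<in> \<Omega>\<close>.\<close>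

definition c_subdifferential ::
    "'a::topological_space set \<Rightarrow> 'b::topological_space set \<Rightarrow> ('a \<times> 'b \<Rightarrow> ereal)
       \<Rightarrow> 'a set \<Rightarrow> ('a \<Rightarrow> ereal) \<Rightarrow> ('a \<times> 'b) set" where
  "c_subdifferential M M' c \<Omega> u =
     {(x, x') \<in> Dom_cost M M' c. x \<in> \<Omega> \<and> (\<forall>y\<in>\<Omega>. u y + c (y, x') \<ge> u x + c (x, x'))}"

definition c_subdifferential_at ::
    "'a::topological_space set \<Rightarrow> 'b::topological_space set \<Rightarrow> ('a \<times> 'b \<Rightarrow> ereal)
       \<Rightarrow> 'a set \<Rightarrow> ('a \<Rightarrow> ereal) \<Rightarrow> 'a \<Rightarrow> 'b set" where
  "c_subdifferential_at M M' c \<Omega> u x = {x' \<in> closure M'. (x, x') \<in> c_subdifferential M M' c \<Omega> u}"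

end

theory Submission
  imports Defs
begin

text \<open>
  Let \<open>\<xi>\<close> be a geodesic seen from \<open>x\<close> with end points in the contact set, and put
  \<open>f t y = c (x, \<xi> t) - c (y, \<xi> t)\<close>. It suffices that \<open>f t y \<le> max (f 0 y) (f 1 y)\<close>; by continuity of
  \<open>c\<close> only the \<open>y\<close> with \<open>(y, \<xi> t) \<in> N\<close> for all \<open>t\<close> matter.

  For fixed \<open>t\<close>, join \<open>x\<close> to \<open>y\<close> by a curve \<open>\<sigma>\<close> that is a geodesic seen from \<open>\<xi> t\<close>. The geodesic
  equation makes \<open>\<partial>\<^sub>t c (\<sigma> s, \<xi> t)\<close> affine in \<open>s\<close>, so if \<open>t\<close> is critical for \<open>f _ y\<close> the vectors
  \<open>\<sigma>' s \<oplus> \<xi>' t\<close> are null for all \<open>s\<close>. The second \<open>s\<close>-derivative of \<open>\<partial>\<^sub>t\<^sup>2 f t (\<sigma> s)\<close> is twice the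
  sectional curvature, hence nonnegative, while value and first derivative vanish at \<open>s = 0\<close> because
  \<open>\<xi>\<close> is a geodesic. So \<open>\<partial>\<^sub>t\<^sup>2 f t y \<ge> 0\<close> whenever \<open>\<partial>\<^sub>t f t y = 0\<close>.

  This alone does not exclude a degenerate maximum (consider \<open>- t\<^sup>4\<close>), but it holds for all
  nearby \<open>y\<close>. Moving \<open>y\<close> slowly with \<open>t\<close>, in a direction \<open>w\<close> with \<open>h (w, \<xi>') > 0\<close>, makes \<open>\<partial>\<^sub>t f\<close> cross
  zero strictly upwards; letting the speed tend to zero, every critical point in \<open>t\<close> is a local
  minimum.
\<close>

section \<open>Chain rule in coordinates, symmetry of second partials, derivatives of inverse
  matrices\<close>

section \<open>Partial derivatives\<close>

lemma partial_eqI: "(f has_derivative f') (at z) \<Longrightarrow> partial i f z = f' (axis i 1)"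
  by (simp add: partial_def frechet_derivative_at[symmetric])

lemma partial_cong:
  assumes "open S" "z \<in> S" "\<And>y. y \<in> S \<Longrightarrow> f y = g y"
  shows "partial i f z = partial i g z"
proof -
  have "(f has_derivative D) (at z) \<longleftrightarrow> (g has_derivative D) (at z)" for D
    using assms by (metis has_derivative_transform_within_open)
  then show ?thesis by (simp add: partial_def frechet_derivative_def)
qed

lemma partial_const [simp]: "partial i (\<lambda>_. a) z = 0"
  by (rule partial_eqI[OF has_derivative_const])

lemma partial_add:
  assumes "f differentiable (at z)" "g differentiable (at z)"
  shows "partial i (\<lambda>y. f y + g y) z = partial i f z + partial i g z"
proof -
  from assms obtain f' g' where "(f has_derivative f') (at z)" "(g has_derivative g') (at z)"
    by (auto simp: differentiable_def)
  then show ?thesis by (simp add: partial_eqI partial_eqI[OF has_derivative_add])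
qed

lemma partial_mult:
  assumes "f differentiable (at z)" "g differentiable (at z)"
  shows "partial i (\<lambda>y. f y * g y) z = f z * partial i g z + partial i f z * g z"
proof -
  from assms obtain f' g' where "(f has_derivative f') (at z)" "(g has_derivative g') (at z)"
    by (auto simp: differentiable_def)
  then show ?thesis by (simp add: partial_eqI partial_eqI[OF has_derivative_mult])
qed

lemma partial_cmult:
  assumes "f differentiable (at z)"
  shows "partial i (\<lambda>y. a * f y) z = a * partial i f z"
  using partial_mult[OF differentiable_const assms, of i a] by simp

lemma partial_sum:
  assumes "finite I" "\<And>k. k \<in> I \<Longrightarrow> f k differentiable (at z)"
  shows "partial i (\<lambda>y. \<Sum>k\<in>I. f k y) z = (\<Sum>k\<in>I. partial i (f k) z)"
  using assms by (induction) (simp_all add: partial_add differentiable_sum)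

lemma has_derivative_eq_sum_partial:
  assumes "(f has_derivative f') (at z)"
  shows "f' v = (\<Sum>k\<in>UNIV. partial k f z * v $ k)"
proof -
  have l: "linear f'" using assms by (rule has_derivative_linear)
  have "f' v = f' (\<Sum>k\<in>UNIV. v $ k *s axis k 1)" by (simp add: basis_expansion)
  also have "\<dots> = (\<Sum>k\<in>UNIV. v $ k * f' (axis k 1))"
    using l by (simp add: linear_sum linear_scale scalar_mult_eq_scaleR)
  finally show ?thesis using assms by (simp add: partial_eqI mult.commute)
qed

lemma has_real_derivative_along_curve:
  fixes f :: "real^'m \<Rightarrow> real"
  assumes "f differentiable (at (\<zeta> t))" "(\<zeta> has_vector_derivative v) (at t within T)"
  shows "((\<lambda>s. f (\<zeta> s)) has_real_derivative (\<Sum>k\<in>UNIV. partial k f (\<zeta> t) * v $ k)) (at t within T)"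
proof -
  obtain f' where f': "(f has_derivative f') (at (\<zeta> t))" using assms(1)
    by (auto simp: differentiable_def)
  have "((\<lambda>s. f (\<zeta> s)) has_derivative (\<lambda>h. f' (h *\<^sub>R v))) (at t within T)"
    using has_derivative_compose[OF assms(2)[unfolded has_vector_derivative_def] f'] .
  moreover have "f' (h *\<^sub>R v) = (\<Sum>k\<in>UNIV. partial k f (\<zeta> t) * v $ k) * h" for h
    by (simp add: has_derivative_eq_sum_partial[OF f'] sum_distrib_left ac_simps)
  ultimately show ?thesis
    by (simp add: has_field_derivative_def mult_commute_abs)
qed

lemma Ck_on_partial: "Ck_on (Suc k) f S \<Longrightarrow> Ck_on k (partial i f) S"
  unfolding partial_def[abs_def] by (auto simp: axis_in_Basis_iff)

lemma Ck_on_SucD: "Ck_on (Suc k) f S \<Longrightarrow> Ck_on k f S"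
proof (induction k arbitrary: f)
  case 0
  then show ?case
    by (auto intro!: continuous_at_imp_continuous_on differentiable_imp_continuous_within)
qed auto

lemma Ck_on_mono: "k \<le> l \<Longrightarrow> Ck_on l f S \<Longrightarrow> Ck_on k f S"
  by (induction rule: dec_induct) (auto simp del: Ck_on.simps dest: Ck_on_SucD)

lemma Ck_on_positive_differentiable: "Ck_on k f S \<Longrightarrow> 0 < k \<Longrightarrow> z \<in> S \<Longrightarrow> f differentiable (at z)"
  by (cases k) auto

text \<open>The mean value theorem is applied first in direction \<open>i\<close>, then in direction
  \<open>j\<close>. The second difference is symmetric in the two directions, which is what
  \<open>partial_commute\<close> exploits. The ball of radius \<open>2 * h\<close> contains the
  square of side \<open>h\<close> on which both applications take place.\<close>

lemma second_difference_eq_second_partial: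
  fixes f :: "real^'m \<Rightarrow> real"
  assumes "Ck_on 2 f (cball z (2 * h))" "0 < h"
  obtains p where "p \<in> cball z (2 * h)"
    "f (z + h *\<^sub>R axis i 1 + h *\<^sub>R axis j 1) - f (z + h *\<^sub>R axis i 1) - f (z + h *\<^sub>R axis j 1) + f z
      = h\<^sup>2 * partial j (partial i f) p"
proof -
  let ?S = "cball z (2 * h)"
  have C1: "Ck_on 1 (partial i f) ?S" using assms(1)
    by (simp add: eval_nat_numeral del: Ck_on.simps add: Ck_on_partial)
  have in_S: "z + s *\<^sub>R axis i 1 + t *\<^sub>R axis j 1 \<in> ?S" if "s \<in> {0..h}" "t \<in> {0..h}" for s t
  proof -
    have "norm (s *\<^sub>R axis i 1 + t *\<^sub>R axis j 1 :: real^'m) \<le> norm (s *\<^sub>R axis i 1 :: real^'m)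
      + norm (t *\<^sub>R axis j 1 :: real^'m)"
      by (rule norm_triangle_ineq)
    also have "\<dots> \<le> 2 * h" using that by simp
    finally show ?thesis by (simp add: dist_norm norm_minus_commute algebra_simps)
  qed
  have axis: "(\<Sum>k\<in>UNIV. u k * (axis l 1 :: real^'m) $ k) = u l" for u :: "'m \<Rightarrow> real" and l
    by (simp add: axis_def if_distrib[of "\<lambda>x. _ * x"] cong: if_cong)
  have der: "((\<lambda>s. g (y + s *\<^sub>R axis l 1)) has_real_derivative partial l g (y + s *\<^sub>R axis l 1))
    (at s)"
    if "g differentiable (at (y + s *\<^sub>R axis l 1))" for g :: "real^'m \<Rightarrow> real" and y l s
  proof -
    have "((\<lambda>s. y + s *\<^sub>R axis l 1) has_vector_derivative axis l 1) (at s)"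
      by (auto intro!: derivative_eq_intros)
    from has_real_derivative_along_curve[OF that this] show ?thesis by (simp add: axis)
  qed
  \<comment> \<open>\<open>G\<close> compares \<open>f\<close> on two parallel segments, so its
    derivative is a difference of two values of \<open>partial i f\<close>; the second application
    resolves that difference.\<close>
  define G where "G s = f ((z + h *\<^sub>R axis j 1) + s *\<^sub>R axis i 1) - f (z + s *\<^sub>R axis i 1)" for s
  have "\<exists>\<theta>. 0 < \<theta> \<and> \<theta> < h \<and> G h - G 0 = (h - 0) *
      (partial i f ((z + h *\<^sub>R axis j 1) + \<theta> *\<^sub>R axis i 1) - partial i f (z + \<theta> *\<^sub>R axis i 1))"
    unfolding G_def
  proof (rule MVT2[OF assms(2)], goal_cases)
    case (1 s)
    show ?case
      using in_S[of s h] in_S[of s 0] 1 assms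
      by (intro DERIV_diff der Ck_on_positive_differentiable[OF assms(1)])
        (auto simp: algebra_simps)
  qed
  then obtain \<theta> where \<theta>: "0 < \<theta>" "\<theta> < h" "G h - G 0 = h *
      (partial i f ((z + h *\<^sub>R axis j 1) + \<theta> *\<^sub>R axis i 1) - partial i f (z + \<theta> *\<^sub>R axis i 1))" by auto
  have "\<exists>\<tau>. 0 < \<tau> \<and> \<tau> < h \<and> partial i f ((z + \<theta> *\<^sub>R axis i 1) + h *\<^sub>R axis j 1)
    - partial i f ((z + \<theta> *\<^sub>R axis i 1) + 0 *\<^sub>R axis j 1)
      = (h - 0) * partial j (partial i f) ((z + \<theta> *\<^sub>R axis i 1) + \<tau> *\<^sub>R axis j 1)"
  proof (rule MVT2[OF assms(2)], goal_cases)
    case (1 s)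
    show ?case
      using in_S[of \<theta> s] 1 \<theta> by (intro der Ck_on_positive_differentiable[OF C1]) auto
  qed
  then obtain \<tau>
    where \<tau>: "0 < \<tau>" "\<tau> < h"
    "partial i f ((z + \<theta> *\<^sub>R axis i 1) + h *\<^sub>R axis j 1) - partial i f (z + \<theta> *\<^sub>R axis i 1)
      = h * partial j (partial i f) ((z + \<theta> *\<^sub>R axis i 1) + \<tau> *\<^sub>R axis j 1)" by auto
  show ?thesis
  proof (rule that)
    show "z + \<theta> *\<^sub>R axis i 1 + \<tau> *\<^sub>R axis j 1 \<in> ?S" using \<theta> \<tau> by (intro in_S) auto
    have sw: "z + h *\<^sub>R axis j 1 + \<theta> *\<^sub>R axis i 1 = z + \<theta> *\<^sub>R axis i 1 + h *\<^sub>R axis j 1"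
      "z + h *\<^sub>R axis j 1 + h *\<^sub>R axis i 1 = z + h *\<^sub>R axis i 1 + h *\<^sub>R axis j 1"
      by (simp_all add: algebra_simps)
    show "f (z + h *\<^sub>R axis i 1 + h *\<^sub>R axis j 1) - f (z + h *\<^sub>R axis i 1) - f (z + h *\<^sub>R axis j 1)
      + f z
      = h\<^sup>2 * partial j (partial i f) (z + \<theta> *\<^sub>R axis i 1 + \<tau> *\<^sub>R axis j 1)"
      using \<theta>(3) \<tau>(3) unfolding G_def sw by (simp add: power2_eq_square)
  qed
qed

lemma Ck_on_subset: "Ck_on k f S \<Longrightarrow> T \<subseteq> S \<Longrightarrow> Ck_on k f T"
  by (induction k arbitrary: f) (auto intro: continuous_on_subset)

text \<open>Exchanging the directions leaves the second difference unchanged, so the two mixed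
  partials agree at some pair of points near \<open>z\<close>; continuity brings both points to
  \<open>z\<close>.\<close>

lemma partial_commute:
  fixes f :: "real^'m \<Rightarrow> real"
  assumes "open S" "Ck_on 2 f S" "z \<in> S"
  shows "partial i (partial j f) z = partial j (partial i f) z"
proof (rule ccontr)
  assume ne: "partial i (partial j f) z \<noteq> partial j (partial i f) z"
  \<comment> \<open>Half of the gap: two errors below \<open>e\<close> cannot bridge it.\<close>
  define e where "e = \<bar>partial i (partial j f) z - partial j (partial i f) z\<bar> / 2"
  have e: "e > 0" using ne by (simp add: e_def)
  have cont: "isCont (partial k (partial l f)) z" for k l
  proof -
    have "Ck_on 0 (partial k (partial l f)) S"
      using assms(2) by (intro Ck_on_partial) (simp add: eval_nat_numeral del: Ck_on.simps)
    then show ?thesis using assms by (simp add: continuous_on_eq_continuous_at)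
  qed
  have near: "\<exists>d>0. \<forall>y. dist y z < d \<longrightarrow> dist (partial k (partial l f) y) (partial k (partial l f) z)
    < e" for k l
    using cont[of k l] e unfolding continuous_at_eps_delta by blast
  obtain d1 where d1: "d1 > 0"
    "\<And>y. dist y z < d1 \<Longrightarrow> dist (partial i (partial j f) y) (partial i (partial j f) z) < e"
    using near by blast
  obtain d2 where d2: "d2 > 0"
    "\<And>y. dist y z < d2 \<Longrightarrow> dist (partial j (partial i f) y) (partial j (partial i f) z) < e"
    using near by blast
  obtain d3 where d3: "d3 > 0" "cball z d3 \<subseteq> S" using assms open_contains_cball by blast
  \<comment> \<open>The factor 4 keeps the ball of radius \<open>2 * h\<close> inside
    \<open>S\<close> and strictly inside the two balls on which the mixed partials vary by less than
    \<open>e\<close>.\<close>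
  define h where "h = min d1 (min d2 d3) / 4"
  have h: "h > 0" "2 * h < d1" "2 * h < d2" "2 * h \<le> d3" using d1 d2 d3 by (auto simp: h_def)
  have C: "Ck_on 2 f (cball z (2 * h))"
    using d3 h by (intro Ck_on_subset[OF assms(2)]) (auto simp: subset_iff)
  obtain p where p: "p \<in> cball z (2 * h)"
    "f (z + h *\<^sub>R axis i 1 + h *\<^sub>R axis j 1) - f (z + h *\<^sub>R axis i 1) - f (z + h *\<^sub>R axis j 1) + f z
      = h\<^sup>2 * partial j (partial i f) p"
    using second_difference_eq_second_partial[OF C h(1)] .
  obtain q where q: "q \<in> cball z (2 * h)"
    "f (z + h *\<^sub>R axis j 1 + h *\<^sub>R axis i 1) - f (z + h *\<^sub>R axis j 1) - f (z + h *\<^sub>R axis i 1) + f z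
      = h\<^sup>2 * partial i (partial j f) q"
    using second_difference_eq_second_partial[OF C h(1)] .
  have "h\<^sup>2 * partial j (partial i f) p = h\<^sup>2 * partial i (partial j f) q"
    unfolding p(2)[symmetric] q(2)[symmetric] by (simp add: algebra_simps)
  then have "partial j (partial i f) p = partial i (partial j f) q" using h by simp
  moreover have "dist (partial j (partial i f) p) (partial j (partial i f) z) < e"
    using p h by (intro d2) (simp add: dist_commute)
  moreover have "dist (partial i (partial j f) q) (partial i (partial j f) z) < e"
    using q h by (intro d1) (simp add: dist_commute)
  ultimately show False by (auto simp: e_def dist_real_def abs_if split: if_splits)
qed

text \<open>Makes derivatives within the interval unique, also at its end points.\<close>

lemma at_within_Icc_neq_bot: "a < b \<Longrightarrow> s \<in> {a..b::real} \<Longrightarrow> at s within {a..b} \<noteq> bot"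
  using islimpt_Icc[of a b s] by (simp add: trivial_limit_within)

lemma DERIV_vec_nth:
  fixes P :: "real \<Rightarrow> real^'k"
  assumes "(P has_vector_derivative P') (at t within T)"
  shows "((\<lambda>s. P s $ i) has_real_derivative P' $ i) (at t within T)"
  using bounded_linear.has_vector_derivative[OF bounded_linear_vec_nth assms]
  by (simp add: has_real_derivative_iff_has_vector_derivative)

lemma DERIV_sum_product:
  fixes P :: "real \<Rightarrow> real^'k::finite"
  assumes "\<And>i. (f i has_real_derivative f' i) (at t within T)"
    "(P has_vector_derivative P') (at t within T)"
  shows "((\<lambda>s. \<Sum>i\<in>UNIV. f i s * P s $ i) has_real_derivative (\<Sum>i\<in>UNIV. f' i * P t $ i)
    + (\<Sum>i\<in>UNIV. f i t * P' $ i)) (at t within T)"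
proof -
  have "((\<lambda>s. \<Sum>i\<in>UNIV. f i s * P s $ i) has_real_derivative
    (\<Sum>i\<in>UNIV. f' i * P t $ i + P' $ i * f i t)) (at t within T)"
    by (intro DERIV_sum DERIV_mult assms DERIV_vec_nth)
  then show ?thesis by (simp add: sum.distrib mult.commute)
qed

lemma differentiable_cong_open:
  assumes "open S" "z \<in> S" "\<And>y. y \<in> S \<Longrightarrow> f y = g y" "g differentiable (at z)"
  shows "f differentiable (at z)"
  using assms unfolding differentiable_def by (metis has_derivative_transform_within_open)

lemma differentiable_prod:
  fixes f :: "'i \<Rightarrow> 'a::real_normed_vector \<Rightarrow> real"
  assumes "\<And>i. i \<in> I \<Longrightarrow> f i differentiable (at z)"
  shows "(\<lambda>y. \<Prod>i\<in>I. f i y) differentiable (at z)"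
proof -
  from assms obtain f' where "\<And>i. i \<in> I \<Longrightarrow> (f i has_derivative f' i) (at z)"
    unfolding differentiable_def by metis
  then show ?thesis unfolding differentiable_def using has_derivative_prod by blast
qed

lemma differentiable_det:
  fixes B :: "'a::real_normed_vector \<Rightarrow> real^'m^'m"
  assumes "\<And>i j. (\<lambda>y. B y $ i $ j) differentiable (at z)"
  shows "(\<lambda>y. det (B y)) differentiable (at z)"
  unfolding det_def using assms
  by (intro differentiable_sum differentiable_mult differentiable_prod differentiable_const ballI)
     (simp_all add: finite_permutations)

lemma matrix_inv_inverse:
  fixes A :: "real^'m^'m"
  assumes "invertible A"
  shows "A ** matrix_inv A = mat 1" "matrix_inv A ** A = mat 1"
  using someI_ex[of "\<lambda>A'. A ** A' = mat 1 \<and> A' ** A = mat 1"] assms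
  by (auto simp: invertible_def matrix_inv_def)

text \<open>Cramer's rule exhibits the entries of the inverse as quotients of polynomials in the
  entries of \<open>B\<close>, so that differentiability carries over to the inverse.\<close>

lemma matrix_inv_entry_cramer:
  fixes B :: "real^'m^'m"
  assumes "invertible B"
  shows "matrix_inv B $ m $ l = det (\<chi> i j. if j = m then axis l 1 $ i else B $ i $ j) / det B"
proof -
  have "B *v column l (matrix_inv B) = column l (B ** matrix_inv B)"
    by (simp add: vec_eq_iff column_def matrix_vector_mult_def matrix_matrix_mult_def)
  also have "\<dots> = axis l 1"
    using assms by (simp add: matrix_inv_inverse vec_eq_iff column_def mat_def axis_def)
  finally have
    "column l (matrix_inv B) = (\<chi> k. det (\<chi> i j. if j = k then axis l 1 $ i else B $ i $ j) / det
    B)"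
    using assms by (subst (asm) cramer) (simp_all add: invertible_det_nz)
  then show ?thesis by (simp add: vec_eq_iff column_def)
qed

lemma differentiable_matrix_inv:
  fixes B :: "'a::real_normed_vector \<Rightarrow> real^'m^'m"
  assumes "open S" "z \<in> S" "\<And>y. y \<in> S \<Longrightarrow> invertible (B y)"
    "\<And>i j. (\<lambda>y. B y $ i $ j) differentiable (at z)"
  shows "(\<lambda>y. matrix_inv (B y) $ m $ l) differentiable (at z)"
proof (rule differentiable_cong_open[OF assms(1,2) matrix_inv_entry_cramer[OF assms(3)]])
  have "(\<lambda>y. det (\<chi> i j. if j = m then axis l 1 $ i else B y $ i $ j)) differentiable (at z)"
    using assms(4) proof (intro differentiable_det)
    fix i j
    show "(\<lambda>y. (\<chi> i j. if j = m then axis l 1 $ i else B y $ i $ j) $ i $ j) differentiable (at z)"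
      using assms(4) by (cases "j = m") auto
  qed
  moreover have "det (B z) \<noteq> 0" using assms by (simp add: invertible_det_nz[symmetric])
  ultimately show
    "(\<lambda>y. det (\<chi> i j. if j = m then axis l 1 $ i else B y $ i $ j) / det (B y)) differentiable
    (at z)"
    using assms(4) by (intro differentiable_divide) (auto intro: differentiable_det)
qed

section \<open>Comparison, maximum and sign principles in one variable\<close>

section \<open>Functions of one real variable\<close>

lemma DERIV_within_Icc_MVT:
  fixes f f' :: "real \<Rightarrow> real"
  assumes "\<And>x. x \<in> {a..b} \<Longrightarrow> (f has_real_derivative f' x) (at x within {a..b})" "a \<le> u" "u < w"
    "w \<le> b"
  obtains \<xi> where "\<xi> \<in> {u<..<w}" "f w - f u = f' \<xi> * (w - u)"
proof -
  have "\<exists>x\<in>{u<..<w}. f w - f u = (\<lambda>x. (*) (f' x)) x (w - u)"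
  proof (rule mvt_simple[OF assms(3)])
    fix x assume "u \<le> x" "x \<le> w"
    then show "(f has_derivative (*) (f' x)) (at x within {u..w})"
      using assms by
        (intro has_derivative_subset[OF assms(1)[of x, unfolded has_field_derivative_def]]) auto
  qed
  then show ?thesis using that by auto
qed

text \<open>\<open>H1\<close> is affine with equal end values, so its derivative vanishes
  identically and the bound \<open>e \<le> 0\<close> applies everywhere. Then \<open>H2\<close> is
  concave with slope 0 at the start, hence cannot increase. The derivatives are only assumed near
  each \<open>s\<close>, because along a geodesic they are computed in charts that change with
  \<open>s\<close>.\<close>

lemma second_order_comparison:
  fixes H1 H2 :: "real \<Rightarrow> real"
  assumes loc: "\<And>s. s \<in> {0..1} \<Longrightarrow> \<exists>d1 d2 e.
      (\<forall>\<^sub>F s' in nhds s. s' \<in> {0..1} \<longrightarrow> (H1 has_real_derivative d1 s') (at s' within {0..1})) \<and>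
      (\<forall>\<^sub>F s' in nhds s. s' \<in> {0..1} \<longrightarrow> (H2 has_real_derivative d2 s') (at s' within {0..1})) \<and>
      (d1 has_real_derivative 0) (at s within {0..1}) \<and>
      (d2 has_real_derivative e) (at s within {0..1}) \<and>
      (d1 s = 0 \<longrightarrow> e \<le> 0) \<and> (s = 0 \<longrightarrow> d2 s = 0)"
    and eq: "H1 0 = H1 1"
  shows "H2 1 \<le> H2 0"
proof -
  \<comment> \<open>Uniqueness of derivatives lets a choice operator glue the local derivatives into
    global ones.\<close>
  define h1 where "h1 s = (SOME d. (H1 has_real_derivative d) (at s within {0..1}))" for s
  define h2 where "h2 s = (SOME d. (H2 has_real_derivative d) (at s within {0..1}))" for s
  have h1_eq: "h1 s = d" if "s \<in> {0..1}" "(H1 has_real_derivative d) (at s within {0..1})" for s d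
    unfolding h1_def using that
    by (intro some_equality has_field_derivative_unique[OF _ that(2)] at_within_Icc_neq_bot) auto
  have h2_eq: "h2 s = d" if "s \<in> {0..1}" "(H2 has_real_derivative d) (at s within {0..1})" for s d
    unfolding h2_def using that
    by (intro some_equality has_field_derivative_unique[OF _ that(2)] at_within_Icc_neq_bot) auto
  have glob: "\<exists>e. (H1 has_real_derivative h1 s) (at s within {0..1})
    \<and> (H2 has_real_derivative h2 s) (at s within {0..1})
      \<and> (h1 has_real_derivative 0) (at s within {0..1})
        \<and> (h2 has_real_derivative e) (at s within {0..1})
      \<and> (h1 s = 0 \<longrightarrow> e \<le> 0) \<and> (s = 0 \<longrightarrow> h2 s = 0)" if s: "s \<in> {0..1}" for s
  proof -
    obtain d1 d2 e where d:
      "\<forall>\<^sub>F s' in nhds s. s' \<in> {0..1} \<longrightarrow> (H1 has_real_derivative d1 s') (at s' within {0..1})"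
      "\<forall>\<^sub>F s' in nhds s. s' \<in> {0..1} \<longrightarrow> (H2 has_real_derivative d2 s') (at s' within {0..1})"
      "(d1 has_real_derivative 0) (at s within {0..1})"
      "(d2 has_real_derivative e) (at s within {0..1})" "d1 s = 0 \<longrightarrow> e \<le> 0" "s = 0 \<longrightarrow> d2 s = 0"
      using loc[OF s] by blast
    have e1: "\<forall>\<^sub>F s' in nhds s. s' \<in> {0..1} \<longrightarrow> h1 s' = d1 s'"
      using d(1) by eventually_elim (simp add: h1_eq)
    have e2: "\<forall>\<^sub>F s' in nhds s. s' \<in> {0..1} \<longrightarrow> h2 s' = d2 s'"
      using d(2) by eventually_elim (simp add: h2_eq)
    have p: "h1 s = d1 s" "h2 s = d2 s"
      "(H1 has_real_derivative d1 s) (at s within {0..1})"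
        "(H2 has_real_derivative d2 s) (at s within {0..1})"
      using eventually_nhds_x_imp_x[OF e1] eventually_nhds_x_imp_x[OF e2]
        eventually_nhds_x_imp_x[OF d(1)] eventually_nhds_x_imp_x[OF d(2)] s by auto
    have "(h1 has_real_derivative 0) (at s within {0..1})"
      using d(3) has_field_derivative_cong_ev[OF refl e1 refl refl s] by simp
    moreover have "(h2 has_real_derivative e) (at s within {0..1})"
      using d(4) has_field_derivative_cong_ev[OF refl e2 refl refl s] by simp
    ultimately show ?thesis using d(5,6) p by metis
  qed
  have H1': "(H1 has_real_derivative h1 s) (at s within {0..1})"
    and H2': "(H2 has_real_derivative h2 s) (at s within {0..1})"
    and h1': "(h1 has_real_derivative 0) (at s within {0..1})" if "s \<in> {0..1}" for s
    using glob[OF that] by blast+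
  \<comment> \<open>Equal end values give \<open>h1\<close> a zero; being constant, it then vanishes
    everywhere.\<close>
  obtain \<xi> where \<xi>: "\<xi> \<in> {0<..<1}" "H1 1 - H1 0 = h1 \<xi> * (1 - 0)"
    using DERIV_within_Icc_MVT[OF H1', of 0 1] by auto
  have "h1 u = h1 w" if "0 \<le> u" "u < w" "w \<le> 1" for u w
    by (rule DERIV_within_Icc_MVT[where f=h1 and f'="\<lambda>_. 0", OF h1' that]) auto
  then have h1_0: "h1 s = 0" if "s \<in> {0..1}" for s
    using \<xi> eq that by (cases s \<xi> rule: linorder_cases) (auto simp: less_imp_le)
  obtain e where e: "\<And>s. s \<in> {0..1} \<Longrightarrow> (h2 has_real_derivative e s) (at s within {0..1}) \<and> e s \<le> 0"
    using glob h1_0 by metis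
  have h2_le: "h2 s \<le> 0" if s: "s \<in> {0..1}" for s
  proof (cases "s = 0")
    case False
    then obtain \<xi>' where "\<xi>' \<in> {0<..<s}" "h2 s - h2 0 = e \<xi>' * (s - 0)"
      using DERIV_within_Icc_MVT[of 0 1 h2 e 0 s] s e by auto
    moreover have "h2 0 = 0" using glob[of 0] by auto
    ultimately show ?thesis using e[of \<xi>'] s by (auto simp: mult_nonpos_nonneg)
  qed (use glob[of 0] in auto)
  obtain \<xi>' where \<xi>': "\<xi>' \<in> {0<..<1}" "H2 1 - H2 0 = h2 \<xi>' * (1 - 0)"
    using DERIV_within_Icc_MVT[OF H2', of 0 1] by auto
  then show ?thesis using h2_le[of \<xi>'] by auto
qed

text \<open>Otherwise the leftmost maximiser is interior, hence critical, hence also a local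
  minimum. Then the function is constant near it, and there are maximisers further to the
  left.\<close>

lemma le_max_endpoints_if_critical_local_min:
  fixes f :: "real \<Rightarrow> real"
  assumes cont: "continuous_on {0..1} f"
    and crit: "\<And>t. t \<in> {0<..<1} \<Longrightarrow> (f has_real_derivative 0) (at t) \<Longrightarrow> \<forall>\<^sub>F s in nhds t. f t \<le> f s"
    and diff: "\<And>t. t \<in> {0<..<1} \<Longrightarrow> f differentiable (at t)"
    and t: "t \<in> {0..1}"
  shows "f t \<le> max (f 0) (f 1)"
proof (rule ccontr)
  assume neg: "\<not> f t \<le> max (f 0) (f 1)"
  obtain m where m: "m \<in> {0..1}" "\<And>s. s \<in> {0..1} \<Longrightarrow> f s \<le> f m"
    using continuous_attains_sup[of "{0..1}" f] cont by auto
  define S where "S = {s \<in> {0..1}. f s = f m}"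
  have "closed S" unfolding S_def
    using continuous_closed_preimage_constant[OF cont, of "f m"] by simp
  then have "compact S" unfolding S_def
    by (metis (no_types, lifting) bounded_closed_interval bounded_subset compact_eq_bounded_closed
    mem_Collect_eq subsetI)
  then obtain a where a: "a \<in> S" "\<And>s. s \<in> S \<Longrightarrow> a \<le> s"
    using compact_attains_inf[of S] m(1) by (auto simp: S_def)
  have a01: "a \<in> {0<..<1}"
    using a(1) neg m(2)[OF t] unfolding S_def by (cases "a = 0"; cases "a = 1") auto
  obtain D where D: "(f has_real_derivative D) (at a)"
    using diff[OF a01] by (auto simp: real_differentiable_def)
  have ev01: "\<forall>\<^sub>F s in nhds a. s \<in> {0<..<1}" using a01 by (intro eventually_nhds_in_open) auto
  then obtain d where d: "d > 0" "\<And>s. \<bar>a - s\<bar> < d \<Longrightarrow> s \<in> {0<..<1}"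
    unfolding eventually_nhds_metric by (auto simp: dist_real_def abs_minus_commute)
  have "f s \<le> f a" if "\<bar>a - s\<bar> < d" for s
    using d(2)[OF that] m(2)[of s] a(1) by (auto simp: S_def)
  then have "D = 0" using DERIV_local_max[OF D d(1)] by blast
  with crit[OF a01] D have "\<forall>\<^sub>F s in nhds a. f a \<le> f s" by simp
  then have "\<forall>\<^sub>F s in nhds a. s \<in> S" using ev01 
  proof eventually_elim
    case (elim s)
    with m(2)[of s] a(1) show ?case by (auto simp: S_def)
  qed
  then obtain e where e: "e > 0" "\<And>s. dist s a < e \<Longrightarrow> s \<in> S" unfolding eventually_nhds_metric by auto
  then show False using a(2)[of "a - e / 2"] e(2)[of "a - e/2"] by (auto simp: dist_real_def)
qed

text \<open>If \<open>\<psi> t\<close> were negative, then just after the last zero before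
  \<open>t\<close> the function would be positive, and the intermediate value theorem would produce
  a later zero.\<close>

lemma sign_of_upcrossing:
  fixes \<psi> \<psi>' :: "real \<Rightarrow> real"
  assumes d: "\<And>t. \<bar>t - a\<bar> < d \<Longrightarrow> (\<psi> has_real_derivative \<psi>' t) (at t)"
    and pos: "\<And>t. \<bar>t - a\<bar> < d \<Longrightarrow> \<psi> t = 0 \<Longrightarrow> \<psi>' t > 0"
    and a: "\<psi> a = 0" and t: "a < t" "t - a < d"
  shows "\<psi> t \<ge> 0"
proof (rule ccontr)
  assume neg: "\<not> \<psi> t \<ge> 0"
  have cont: "continuous_on {a..t} \<psi>"
    using t by (intro continuous_at_imp_continuous_on ballI DERIV_isCont[OF d]) auto
  define Z where "Z = {s \<in> {a..t}. \<psi> s = 0}"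
  have "closed Z" unfolding Z_def using continuous_closed_preimage_constant[OF cont, of 0] by simp
  then have "compact Z" unfolding Z_def
    by (metis (no_types, lifting) bounded_closed_interval bounded_subset compact_eq_bounded_closed
    mem_Collect_eq subsetI)
  moreover have "a \<in> Z" using a t by (simp add: Z_def)
  ultimately obtain z where z: "z \<in> Z" "\<And>s. s \<in> Z \<Longrightarrow> s \<le> z" using compact_attains_sup[of Z] by auto
  have zt: "a \<le> z" "z < t" "\<psi> z = 0" using z(1) neg by (auto simp: Z_def less_le)
  then have "\<psi>' z > 0" "(\<psi> has_real_derivative \<psi>' z) (at z)" using d pos t by auto
  then obtain e where e: "e > 0" "\<And>h. 0 < h \<Longrightarrow> h < e \<Longrightarrow> \<psi> z < \<psi> (z + h)"
    using DERIV_pos_inc_right by blast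
  \<comment> \<open>Close enough to \<open>z\<close> for \<open>\<psi> w\<close> to be positive, and
    still to the left of \<open>t\<close>.\<close>
  define w where "w = z + min (e/2) ((t - z)/2)"
  have w: "z < w" "w < t" using e(1) zt by (auto simp: w_def min_def field_simps)
  have \<psi>w: "\<psi> w > 0" using e(2)[of "w - z"] e(1) zt w by (auto simp: w_def min_def)
  have "\<exists>s\<ge>w. s \<le> t \<and> \<psi> s = 0"
    using w \<psi>w neg zt by (intro IVT2' continuous_on_subset[OF cont]) auto
  then obtain s where "w \<le> s" "s \<le> t" "\<psi> s = 0" by blast
  then show False using z(2)[of s] w zt by (auto simp: Z_def)
qed

text \<open>Reflecting at \<open>a\<close> and changing the sign preserves upward crossings and
  reduces this to \<open>sign_of_upcrossing\<close>.\<close>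

lemma sign_of_upcrossing_left:
  fixes \<psi> \<psi>' :: "real \<Rightarrow> real"
  assumes d: "\<And>t. \<bar>t - a\<bar> < d \<Longrightarrow> (\<psi> has_real_derivative \<psi>' t) (at t)"
    and pos: "\<And>t. \<bar>t - a\<bar> < d \<Longrightarrow> \<psi> t = 0 \<Longrightarrow> \<psi>' t > 0"
    and a: "\<psi> a = 0" and t: "t < a" "a - t < d"
  shows "\<psi> t \<le> 0"
proof -
  have "- \<psi> (2 * a - (2 * a - t)) \<ge> 0"
  proof (rule sign_of_upcrossing[where a=a and d=d and \<psi>="\<lambda>u. - \<psi> (2 * a - u)" and
    \<psi>'="\<lambda>u. \<psi>' (2 * a - u)"])
    fix u assume u: "\<bar>u - a\<bar> < d"
    then have u': "\<bar>2 * a - u - a\<bar> < d" by simp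
    show "((\<lambda>u. - \<psi> (2 * a - u)) has_real_derivative \<psi>' (2 * a - u)) (at u)"
    proof -
      have "((\<lambda>u. 2 * a - u) has_real_derivative - 1) (at u)"
        by (auto intro!: derivative_eq_intros)
      from DERIV_minus[OF DERIV_chain2[where g="\<lambda>u. 2 * a - u" and x=u and s=UNIV,
        OF d[OF u'] this]]
      show ?thesis by simp
    qed
    show "\<psi>' (2 * a - u) > 0" if "- \<psi> (2 * a - u) = 0"
      using pos[OF u'] that by simp
  qed (use a t in auto)
  then show ?thesis by simp
qed

lemma isCont_tendsto_nhds: "isCont f x \<Longrightarrow> (f \<longlongrightarrow> f x) (nhds x)"
  by (simp add: isCont_def tendsto_at_iff_tendsto_nhds)

section \<open>Christoffel symbols, curvature and geodesics in one pair of charts\<close>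

section \<open>Curvature of an off-diagonal metric\<close>

text \<open>Abstracts the cost and its metric in one pair of charts. The test \<open>isl\<close>
  tells the factors apart, so that one statement can serve for both of them.\<close>

locale off_diagonal_metric =
  fixes W :: "(real^('n::finite + 'n)) set"
    and C :: "real^('n + 'n) \<Rightarrow> real"
    and g :: "real^('n + 'n) \<Rightarrow> real^('n + 'n)^('n + 'n)"
  assumes open_W: "open W"
    and C4: "Ck_on 4 C W"
    and g_eq: "z \<in> W \<Longrightarrow> g z $ k $ l = (if isl k = isl l then 0 else - partial k (partial l C) z / 2)"
    and g_invertible: "z \<in> W \<Longrightarrow> invertible (g z)"
begin

lemma C3: "Ck_on 3 (partial i C) W"
  using Ck_on_partial[of 3 C W i] C4 by (simp add: eval_nat_numeral del: Ck_on.simps)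

lemma C2: "Ck_on 2 (partial j (partial i C)) W"
  using Ck_on_partial[of 2 "partial i C" W j] C3 by (simp add: eval_nat_numeral del: Ck_on.simps)

lemma C1: "Ck_on 1 (partial k (partial j (partial i C))) W"
  using Ck_on_partial[of 1 "partial j (partial i C)" W k] C2
    by (simp add: eval_nat_numeral del: Ck_on.simps)

lemma
  assumes "z \<in> W"
  shows differentiable_C: "C differentiable (at z)"
    and differentiable_partial: "partial i C differentiable (at z)"
    and differentiable_partial2: "partial i (partial j C) differentiable (at z)"
    and differentiable_partial3: "partial i (partial j (partial k C)) differentiable (at z)"
  using Ck_on_positive_differentiable[OF C4 _ assms] Ck_on_positive_differentiable[OF C3 _ assms]
    Ck_on_positive_differentiable[OF C2 _ assms] Ck_on_positive_differentiable[OF C1 _ assms]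
  by auto

lemma partial2_commute: "z \<in> W \<Longrightarrow> partial i (partial j C) z = partial j (partial i C) z"
  by (rule partial_commute[OF open_W]) (auto intro: Ck_on_mono[OF _ C4])

lemma
  assumes "z \<in> W"
  shows partial3_commute12:
    "partial i (partial j (partial k C)) z = partial j (partial i (partial k C)) z"
    and partial3_commute23:
      "partial i (partial j (partial k C)) z = partial i (partial k (partial j C)) z"
proof -
  show "partial i (partial j (partial k C)) z = partial j (partial i (partial k C)) z"
    by (rule partial_commute[OF open_W _ assms]) (auto intro: Ck_on_mono[OF _ C3])
  show "partial i (partial j (partial k C)) z = partial i (partial k (partial j C)) z"
    by (rule partial_cong[OF open_W assms]) (rule partial2_commute)
qed

lemma
  assumes "z \<in> W"
  shows partial4_commute12:
    "partial i (partial j (partial k (partial l C))) z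
    = partial j (partial i (partial k (partial l C))) z"
    and partial4_commute23:
      "partial i (partial j (partial k (partial l C))) z
      = partial i (partial k (partial j (partial l C))) z"
proof -
  show "partial i (partial j (partial k (partial l C))) z
    = partial j (partial i (partial k (partial l C))) z"
    by (rule partial_commute[OF open_W C2 assms])
  show "partial i (partial j (partial k (partial l C))) z
    = partial i (partial k (partial j (partial l C))) z"
    by (rule partial_cong[OF open_W assms]) (rule partial3_commute12)
qed

lemma partial_g:
  assumes "z \<in> W"
  shows "partial i (\<lambda>y. g y $ k $ l) z
    = (if isl k = isl l then 0 else - partial i (partial k (partial l C)) z / 2)"
proof (cases "isl k = isl l")
  case True
  then have "partial i (\<lambda>y. g y $ k $ l) z = partial i (\<lambda>y. 0) z"
    by (intro partial_cong[OF open_W assms]) (simp add: g_eq)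
  with True show ?thesis by simp
next
  case False
  then have "partial i (\<lambda>y. g y $ k $ l) z = partial i (\<lambda>y. (-1/2) * partial k (partial l C) y) z"
    by (intro partial_cong[OF open_W assms]) (simp add: g_eq)
  with False show ?thesis using assms by (simp only: partial_cmult differentiable_partial2) simp
qed

lemma differentiable_g:
  assumes "z \<in> W"
  shows "(\<lambda>y. g y $ k $ l) differentiable (at z)"
proof (rule differentiable_cong_open[OF open_W assms])
  show "(\<lambda>z. if isl k = isl l then 0 else - partial k (partial l C) z / 2) differentiable (at z)"
    using assms by (cases "isl k = isl l") (simp_all add: differentiable_partial2)
qed (rule g_eq)

lemma differentiable_partial_g:
  assumes "z \<in> W"
  shows "(partial i (\<lambda>y. g y $ k $ l)) differentiable (at z)"
proof (rule differentiable_cong_open[OF open_W assms])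
  show "(\<lambda>z. if isl k = isl l then 0 else - partial i (partial k (partial l C)) z / 2)
    differentiable (at z)"
    using assms by (cases "isl k = isl l") (simp_all add: differentiable_partial3)
qed (rule partial_g)

lemma differentiable_christoffel:
  assumes "z \<in> W"
  shows "christoffel g m i j differentiable (at z)"
proof -
  have "(\<lambda>z. partial i (\<lambda>y. g y $ k $ l) z) differentiable (at z)" for i k l
    using differentiable_partial_g[OF assms] by simp
  then show ?thesis unfolding christoffel_def[abs_def] using assms
    by (intro differentiable_divide differentiable_sum differentiable_mult differentiable_diff
        differentiable_add differentiable_const differentiable_matrix_inv[OF open_W] ballI)
      (auto simp: g_invertible differentiable_g)
qed

text \<open>Lowering the index cancels the inverse matrix, so that later computations need none of
  its entries.\<close>

lemma christoffel_lowered: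
  assumes "z \<in> W"
  shows "(\<Sum>m\<in>UNIV. g z $ n $ m * christoffel g m i j z) =
     (partial i (\<lambda>y. g y $ j $ n) z + partial j (\<lambda>y. g y $ i $ n) z - partial n (\<lambda>y. g y $ i $ j) z)
       / 2"
proof -
  define X where
    "X l = partial i (\<lambda>y. g y $ j $ l) z + partial j (\<lambda>y. g y $ i $ l) z
    - partial l (\<lambda>y. g y $ i $ j) z" for l
  have "(\<Sum>m\<in>UNIV. g z $ n $ m * christoffel g m i j z)
      = (\<Sum>m\<in>UNIV. \<Sum>l\<in>UNIV. g z $ n $ m * matrix_inv (g z) $ m $ l * X l / 2)"
    by (simp add: christoffel_def X_def sum_distrib_left sum_divide_distrib mult.assoc)
  also have "\<dots> = (\<Sum>l\<in>UNIV. (g z ** matrix_inv (g z)) $ n $ l * X l / 2)"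
    by (subst sum.swap) (simp add: matrix_matrix_mult_def sum_distrib_right sum_divide_distrib)
  also have "\<dots> = (\<Sum>l\<in>UNIV. if n = l then X l / 2 else 0)"
    using assms by (intro sum.cong) (simp_all add: matrix_inv_inverse g_invertible mat_def)
  also have "\<dots> = X n / 2" by simp
  finally show ?thesis by (simp add: X_def)
qed

text \<open>The form in which invertibility is used: a quantity vanishes once its lowered version
  does.\<close>

lemma g_kernel:
  assumes "z \<in> W" "\<And>n. (\<Sum>m\<in>UNIV. g z $ n $ m * X m) = 0"
  shows "X m = 0"
proof -
  have "g z *v (\<chi> m. X m) = 0" using assms by (simp add: vec_eq_iff matrix_vector_mult_def)
  moreover have "\<exists>B. B ** g z = mat 1" using g_invertible[OF assms(1)]
    by (auto simp: invertible_def)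
  ultimately have "(\<chi> m. X m) = 0" by (simp add: matrix_left_invertible_ker)
  then show ?thesis by (simp add: vec_eq_iff)
qed

text \<open>Only symbols with all three indices in one factor survive. For \<open>i\<close> and
  \<open>j\<close> in different factors every lowered symbol vanishes by symmetry of third
  derivatives. For \<open>i\<close> and \<open>j\<close> in the same factor the lowered symbols with
  third index in that factor vanish, and lowering exchanges the factors.\<close>

lemma christoffel_eq_0:
  assumes "z \<in> W" "\<not> (isl i = isl j \<and> isl j = isl m)"
  shows "christoffel g m i j z = 0"
proof (cases "isl i = isl j")
  case False
  show ?thesis
  proof (rule g_kernel[OF assms(1), where X="\<lambda>m. christoffel g m i j z"])
    fix n
    show "(\<Sum>m\<in>UNIV. g z $ n $ m * christoffel g m i j z) = 0"
      using assms(1) False partial3_commute12[OF assms(1)] partial3_commute23[OF assms(1)]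
      by (auto simp: christoffel_lowered partial_g)
  qed
next
  case True
  \<comment> \<open>Only the components in the opposite factor are kept. Rows of \<open>g\<close> in
    the factor of \<open>i\<close> see exactly these, and rows in the opposite factor do not see
    them at all.\<close>
  let ?X = "\<lambda>m. if isl m = isl i then 0 else christoffel g m i j z"
  have "?X m = 0"
  proof (rule g_kernel[OF assms(1), where X="?X"])
    fix n
    show "(\<Sum>m\<in>UNIV. g z $ n $ m * ?X m) = 0"
    proof (cases "isl n = isl i")
      case same: True
      have "(\<Sum>m\<in>UNIV. g z $ n $ m * ?X m) = (\<Sum>m\<in>UNIV. g z $ n $ m * christoffel g m i j z)"
        by (rule sum.cong) (use assms(1) same in \<open>auto simp: g_eq\<close>)
      also have "\<dots> = 0" using assms(1) same True by (simp add: christoffel_lowered partial_g)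
      finally show ?thesis .
    next
      case False
      then show ?thesis using assms(1) by (intro sum.neutral) (auto simp: g_eq)
    qed
  qed
  with True assms(2) show ?thesis by auto
qed

text \<open>The term with \<open>g i j\<close> drops out and the other two agree by symmetry, which
  leaves a pure third derivative of the cost.\<close>

lemma g_christoffel:
  assumes "z \<in> W" "isl i = isl j" "isl n \<noteq> isl i"
  shows "(\<Sum>m\<in>UNIV. g z $ n $ m * christoffel g m i j z)
    = - partial i (partial j (partial n C)) z / 2"
  using assms partial3_commute12[OF assms(1), of i j n]
  by (simp add: christoffel_lowered partial_g)

lemma partial_christoffel_eq_0:
  assumes "z \<in> W" "\<not> (isl i = isl j \<and> isl j = isl m)"
  shows "partial k (christoffel g m i j) z = 0"
  using partial_cong[OF open_W assms(1), of "christoffel g m i j" "\<lambda>_. 0"] christoffel_eq_0 assms(2)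
    by simp

text \<open>Each product of Christoffel symbols contains one with mixed indices and so vanishes, as
  does one of the two derivative terms.\<close>

lemma riemann_mixed:
  assumes "z \<in> W" "isl k = isl i" "isl m = isl i" "isl j \<noteq> isl i"
  shows "riemann g i j k m z = partial j (christoffel g m i k) z"
proof -
  have "(\<Sum>f\<in>UNIV. christoffel g f k i z * christoffel g m j f z) = 0"
    using assms by (intro sum.neutral) (auto simp: christoffel_eq_0)
  moreover have "(\<Sum>f\<in>UNIV. christoffel g f k j z * christoffel g m i f z) = 0"
    using assms by (intro sum.neutral) (auto simp: christoffel_eq_0)
  moreover have "partial i (christoffel g m j k) z = 0"
    using assms by (intro partial_christoffel_eq_0) auto
  ultimately show ?thesis by (simp add: riemann_def)
qed

text \<open>Differentiating \<open>g_christoffel\<close> in direction \<open>j\<close> yields the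
  derivative of the symbols contracted with \<open>g\<close>, so no derivative of an inverse matrix
  has to be computed.\<close>

lemma riemann_lowered_mixed:
  assumes "z \<in> W" "isl k = isl i" "isl l = isl j" "isl j \<noteq> isl i"
  shows "riemann_lowered g i j k l z = - (partial i (partial k (partial j (partial l C))) z
      - (\<Sum>m\<in>UNIV. partial m (partial j (partial l C)) z * christoffel g m i k z)) / 2"
proof -
  let ?\<Gamma> = "\<lambda>m. christoffel g m i k"
  have "riemann_lowered g i j k l z = (\<Sum>m\<in>UNIV. g z $ l $ m * partial j (?\<Gamma> m) z)"
    unfolding riemann_lowered_def
  proof (rule sum.cong)
    fix m :: "'n + 'n"
    show "riemann g i j k m z * g z $ m $ l = g z $ l $ m * partial j (?\<Gamma> m) z"
      using assms by (cases "isl m = isl i") (auto simp: riemann_mixed g_eq partial2_commute)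
  qed simp
  \<comment> \<open>The product rule: its first terms are the lowered curvature, its second ones the
    correction by third derivatives.\<close>
  moreover have "partial j (\<lambda>y. \<Sum>m\<in>UNIV. g y $ l $ m * ?\<Gamma> m y) z
      = (\<Sum>m\<in>UNIV. g z $ l $ m * partial j (?\<Gamma> m) z + partial j (\<lambda>y. g y $ l $ m) z * ?\<Gamma> m z)"
    using assms(1)
      by (simp add: partial_sum partial_mult differentiable_mult differentiable_g
      differentiable_christoffel)
  moreover have "partial j (\<lambda>y. \<Sum>m\<in>UNIV. g y $ l $ m * ?\<Gamma> m y) z
      = partial j (\<lambda>y. (-1/2) * partial i (partial k (partial l C)) y) z"
    by (rule partial_cong[OF open_W assms(1)]) (use assms in \<open>simp add: g_christoffel\<close>)
  moreover have "\<dots> = - partial j (partial i (partial k (partial l C))) z / 2"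
    using assms(1) by (simp only: partial_cmult differentiable_partial3)
  moreover have
    "partial j (partial i (partial k (partial l C))) z
    = partial i (partial k (partial j (partial l C))) z"
    using assms(1) partial4_commute12 partial4_commute23 by metis
  moreover have "(\<Sum>m\<in>UNIV. partial j (\<lambda>y. g y $ l $ m) z * ?\<Gamma> m z)
      = - (\<Sum>m\<in>UNIV. partial m (partial j (partial l C)) z * ?\<Gamma> m z) / 2"
  proof -
    have "partial j (\<lambda>y. g y $ l $ m) z * ?\<Gamma> m z
      = - (partial m (partial j (partial l C)) z * ?\<Gamma> m z) / 2" for m
    proof (cases "isl m = isl i")
      case True
      with assms show ?thesis
        using partial3_commute12[OF assms(1)] partial3_commute23[OF assms(1)]
        by (simp add: partial_g)
    next
      case False
      with assms show ?thesis by (auto simp: christoffel_eq_0)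
    qed
    then show ?thesis by (simp add: sum_negf sum_divide_distrib)
  qed
  ultimately show ?thesis by (simp add: sum.distrib field_simps)
qed

text \<open>With this abbreviation the geodesic equation says that the acceleration is
  \<open>- \<Gamma> z v\<close>, where \<open>v\<close> is the velocity at \<open>z\<close>.\<close>

definition \<Gamma> :: "real^('n + 'n) \<Rightarrow> real^('n + 'n) \<Rightarrow> real^('n + 'n)" where
  "\<Gamma> z v = (\<chi> m. \<Sum>i\<in>UNIV. \<Sum>j\<in>UNIV. christoffel g m i j z * v $ i * v $ j)"

lemma sec_mixed:
  assumes "z \<in> W" "\<And>k. \<not> isl k \<Longrightarrow> P $ k = 0" "\<And>k. isl k \<Longrightarrow> Q $ k = 0"
  shows "sec g z P Q = - ((\<Sum>j\<in>UNIV. \<Sum>l\<in>UNIV. (\<Sum>i\<in>UNIV. \<Sum>k\<in>UNIV.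
           partial i (partial k (partial j (partial l C))) z * P $ i * P $ k) * Q $ j * Q $ l)
      - (\<Sum>j\<in>UNIV. \<Sum>l\<in>UNIV. (\<Sum>m\<in>UNIV. partial m (partial j (partial l C)) z * \<Gamma> z P $ m) * Q $ j * Q
        $ l)) / 2"
proof -
  let ?R = "\<lambda>i j k l. - (partial i (partial k (partial j (partial l C))) z
      - (\<Sum>m\<in>UNIV. partial m (partial j (partial l C)) z * christoffel g m i k z)) / 2"
  \<comment> \<open>The formula \<open>?R\<close> may replace the curvature for all indices: outside
    the mixed pattern a component of \<open>P\<close> or of \<open>Q\<close> is zero.\<close>
  have eq: "riemann_lowered g i j k l z * P $ i * Q $ j * P $ k * Q $ l
    = ?R i j k l * P $ i * Q $ j * P $ k * Q $ l" for i j k l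
  proof (cases "isl i \<and> isl k \<and> \<not> isl j \<and> \<not> isl l")
    case True
    with assms(1) show ?thesis by (simp add: riemann_lowered_mixed)
  next
    case False
    then show ?thesis using assms by auto
  qed
  have 1: "(\<Sum>m\<in>UNIV. partial m (partial j (partial l C)) z * \<Gamma> z P $ m)
     = (\<Sum>i\<in>UNIV. \<Sum>k\<in>UNIV. (\<Sum>m\<in>UNIV. partial m (partial j (partial l C)) z * christoffel g m i k z) *
       P $ i * P $ k)" for j l
  proof -
    have "(\<Sum>m\<in>UNIV. partial m (partial j (partial l C)) z * \<Gamma> z P $ m)
      = (\<Sum>m\<in>UNIV. \<Sum>i\<in>UNIV. \<Sum>k\<in>UNIV. partial m (partial j (partial l C)) z * christoffel g m i k z *
        P $ i * P $ k)"
      by (simp add: \<Gamma>_def sum_distrib_left mult.assoc)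
    also have "\<dots> = (\<Sum>i\<in>UNIV. \<Sum>k\<in>UNIV. \<Sum>m\<in>UNIV. partial m (partial j (partial l C)) z * christoffel g
      m i k z * P $ i * P $ k)"
      by (rule trans[OF sum.swap]) (rule sum.cong[OF refl], rule sum.swap)
    finally show ?thesis by (simp add: sum_distrib_right)
  qed
  have "sec g z P Q = (\<Sum>i\<in>UNIV. \<Sum>j\<in>UNIV. \<Sum>k\<in>UNIV. \<Sum>l\<in>UNIV. ?R i j k l * P $ i * Q $ j * P $ k * Q $
    l)"
    unfolding sec_def eq ..
  also have "\<dots> = (\<Sum>j\<in>UNIV. \<Sum>i\<in>UNIV. \<Sum>l\<in>UNIV. \<Sum>k\<in>UNIV. ?R i j k l * P $ i * Q $ j * P $ k * Q $ l)"
    by (rule trans[OF sum.swap]) (rule sum.cong[OF refl], rule sum.cong[OF refl], rule sum.swap)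
  also have "\<dots> = (\<Sum>j\<in>UNIV. \<Sum>l\<in>UNIV. \<Sum>i\<in>UNIV. \<Sum>k\<in>UNIV. ?R i j k l * P $ i * Q $ j * P $ k * Q $ l)"
    by (rule sum.cong[OF refl], rule sum.swap)
  also have "\<dots> = (\<Sum>j\<in>UNIV. \<Sum>l\<in>UNIV. \<Sum>i\<in>UNIV. \<Sum>k\<in>UNIV.
      - ((partial i (partial k (partial j (partial l C))) z * P $ i * P $ k) * Q $ j * Q $ l
      - ((\<Sum>m\<in>UNIV. partial m (partial j (partial l C)) z * christoffel g m i k z) * P $ i * P $ k) *
        Q $ j * Q $ l) / 2)"
    by (intro sum.cong refl) (simp add: algebra_simps)
  also have "\<dots> = - ((\<Sum>j\<in>UNIV. \<Sum>l\<in>UNIV. (\<Sum>i\<in>UNIV. \<Sum>k\<in>UNIV.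
           partial i (partial k (partial j (partial l C))) z * P $ i * P $ k) * Q $ j * Q $ l)
      - (\<Sum>j\<in>UNIV. \<Sum>l\<in>UNIV.
        (\<Sum>i\<in>UNIV. \<Sum>k\<in>UNIV. (\<Sum>m\<in>UNIV. partial m (partial j (partial l C)) z * christoffel g m i k z)
        * P $ i * P $ k) * Q $ j * Q $ l)) / 2"
    by (simp only: sum_divide_distrib[symmetric] sum_negf sum_subtractf
      sum_distrib_right[symmetric])
  finally show ?thesis unfolding 1 .
qed

text \<open>Along a geodesic in one factor, the differential of the cost in the other factor is affine.\<close>

lemma geodesic_identity:
  assumes "z \<in> W" "\<And>k. isl k = isl n \<Longrightarrow> v $ k = 0"
  shows "(\<Sum>k\<in>UNIV. partial k (partial n C) z * \<Gamma> z v $ k)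
     = (\<Sum>i\<in>UNIV. \<Sum>j\<in>UNIV. partial i (partial j (partial n C)) z * v $ i * v $ j)"
proof -
  \<comment> \<open>\<open>v\<close> lives in the factor that does not contain \<open>n\<close>, and
    unmixed symbols keep \<open>\<Gamma> z v\<close> in that factor.\<close>
  have Gm0: "\<Gamma> z v $ k = 0" if "isl k = isl n" for k
  proof -
    have "christoffel g k i j z * v $ i * v $ j = 0" for i j
      using that assms christoffel_eq_0[OF assms(1), of i j k] by (cases "isl i = isl n") auto
    then show ?thesis by (simp only: \<Gamma>_def vec_lambda_beta sum.neutral_const)
  qed
  have "(\<Sum>k\<in>UNIV. partial k (partial n C) z * \<Gamma> z v $ k)
    = (\<Sum>k\<in>UNIV. - 2 * (g z $ n $ k * \<Gamma> z v $ k))"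
    using assms(1) by (intro sum.cong refl) (auto simp: g_eq Gm0 partial2_commute)
  also have "\<dots> = - 2 * (\<Sum>k\<in>UNIV. \<Sum>i\<in>UNIV. \<Sum>j\<in>UNIV. g z $ n $ k * christoffel g k i j z * v $ i * v $
    j)"
    by (simp add: \<Gamma>_def sum_distrib_left mult.assoc)
  also have "\<dots> = - 2 * (\<Sum>i\<in>UNIV. \<Sum>j\<in>UNIV. (\<Sum>k\<in>UNIV. g z $ n $ k * christoffel g k i j z) * v $ i * v
    $ j)"
    unfolding sum_distrib_right
    by (rule arg_cong[of _ _ "(*) (-2)"], rule trans[OF sum.swap], rule sum.cong[OF refl],
      rule sum.swap)
  also have "\<dots> = - 2 * (\<Sum>i\<in>UNIV. \<Sum>j\<in>UNIV. - (partial i (partial j (partial n C)) z * v $ i * v $ j)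
    / 2)"
  proof (intro arg_cong[of _ _ "(*) (-2)"] sum.cong refl)
    fix i j
    show "(\<Sum>k\<in>UNIV. g z $ n $ k * christoffel g k i j z) * v $ i * v $ j
      = - (partial i (partial j (partial n C)) z * v $ i * v $ j) / 2"
    proof (cases "isl i = isl n \<or> isl j = isl n")
      case True
      then show ?thesis using assms(2) by auto
    next
      case False
      then show ?thesis using assms(1) by (simp add: g_christoffel)
    qed
  qed
  finally show ?thesis by (simp add: sum_divide_distrib[symmetric] sum_negf)
qed

section \<open>Differentials of the cost contracted with vectors, and their derivatives along
  curves\<close>

definition D1 :: "real^('n + 'n) \<Rightarrow> real^('n + 'n) \<Rightarrow> real" where
  "D1 z P = (\<Sum>i\<in>UNIV. partial i C z * P $ i)"

text \<open>The brackets nest outwards from the first slot, here and in \<open>D3\<close> and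
  \<open>D4\<close>, so that \<open>DERIV_sum_product\<close> can differentiate along a curve slot
  by slot.\<close>

definition D2 :: "real^('n + 'n) \<Rightarrow> real^('n + 'n) \<Rightarrow> real^('n + 'n) \<Rightarrow> real" where
  "D2 z P Q = (\<Sum>j\<in>UNIV. (\<Sum>i\<in>UNIV. partial i (partial j C) z * P $ i) * Q $ j)"

definition D3 :: "real^('n + 'n) \<Rightarrow> real^('n + 'n) \<Rightarrow> real^('n + 'n) \<Rightarrow> real^('n + 'n) \<Rightarrow> real" where
  "D3 z P Q R = (\<Sum>k\<in>UNIV. (\<Sum>j\<in>UNIV. (\<Sum>i\<in>UNIV. partial i (partial j (partial k C)) z * P $ i) * Q $
    j) * R $ k)"

definition D4 ::
  "real^('n + 'n) \<Rightarrow> real^('n + 'n) \<Rightarrow> real^('n + 'n) \<Rightarrow> real^('n + 'n) \<Rightarrow> real^('n + 'n) \<Rightarrow> real" where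
  "D4 z P Q R S = (\<Sum>l\<in>UNIV. (\<Sum>k\<in>UNIV. (\<Sum>j\<in>UNIV. (\<Sum>i\<in>UNIV.
      partial i (partial j (partial k (partial l C))) z * P $ i) * Q $ j) * R $ k) * S $ l)"

context
  fixes \<zeta> :: "real \<Rightarrow> real^('n + 'n)" and v t T
  assumes \<zeta>: "\<zeta> t \<in> W" "(\<zeta> has_vector_derivative v) (at t within T)"
begin

lemma DERIV_C: "((\<lambda>s. C (\<zeta> s)) has_real_derivative D1 (\<zeta> t) v) (at t within T)"
  unfolding D1_def by (intro has_real_derivative_along_curve \<zeta> differentiable_C)

lemma DERIV_D1:
  assumes "(P has_vector_derivative P') (at t within T)"
  shows "((\<lambda>s. D1 (\<zeta> s) (P s)) has_real_derivative D2 (\<zeta> t) v (P t) + D1 (\<zeta> t) P') (at t within T)"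
  unfolding D1_def D2_def
  by (intro DERIV_sum_product assms has_real_derivative_along_curve \<zeta> differentiable_partial)

lemma DERIV_D2:
  assumes "(P has_vector_derivative P') (at t within T)"
    "(Q has_vector_derivative Q') (at t within T)"
  shows "((\<lambda>s. D2 (\<zeta> s) (P s) (Q s)) has_real_derivative
      D3 (\<zeta> t) v (P t) (Q t) + D2 (\<zeta> t) P' (Q t) + D2 (\<zeta> t) (P t) Q') (at t within T)"
proof -
  have "((\<lambda>s. D2 (\<zeta> s) (P s) (Q s)) has_real_derivative
     (\<Sum>j\<in>UNIV. ((\<Sum>i\<in>UNIV. (\<Sum>k\<in>UNIV. partial k (partial i (partial j C)) (\<zeta> t) * v $ k) * P t $ i)
        + (\<Sum>i\<in>UNIV. partial i (partial j C) (\<zeta> t) * P' $ i)) * Q t $ j)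
      + (\<Sum>j\<in>UNIV. (\<Sum>i\<in>UNIV. partial i (partial j C) (\<zeta> t) * P t $ i) * Q' $ j)) (at t within T)"
    unfolding D2_def
    by (intro DERIV_sum_product assms has_real_derivative_along_curve \<zeta> differentiable_partial2)
  then show ?thesis by (simp add: D2_def D3_def distrib_right sum.distrib)
qed

lemma DERIV_D3:
  assumes "(P has_vector_derivative P') (at t within T)"
  shows "((\<lambda>s. D3 (\<zeta> s) (P s) Q R) has_real_derivative
      D4 (\<zeta> t) v (P t) Q R + D3 (\<zeta> t) P' Q R) (at t within T)"
proof -
  have "((\<lambda>s. D3 (\<zeta> s) (P s) Q R) has_real_derivative
     (\<Sum>k\<in>UNIV. (\<Sum>j\<in>UNIV.
       ((\<Sum>i\<in>UNIV. (\<Sum>l\<in>UNIV. partial l (partial i (partial j (partial k C))) (\<zeta> t) * v $ l) * P t $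
       i)
        + (\<Sum>i\<in>UNIV. partial i (partial j (partial k C)) (\<zeta> t) * P' $ i)) * Q $ j) * R $ k))
          (at t within T)"
    unfolding D3_def
    by (intro DERIV_sum DERIV_cmult_right DERIV_sum_product assms
      has_real_derivative_along_curve \<zeta> differentiable_partial3)
  then show ?thesis by (simp add: D4_def D3_def distrib_right sum.distrib)
qed

end

lemma D2_add_left: "D2 z (P + P') Q = D2 z P Q + D2 z P' Q"
  by (simp add: D2_def distrib_left distrib_right sum.distrib)

lemma D2_scale_left: "D2 z (r *\<^sub>R P) Q = r * D2 z P Q"
  by (simp add: D2_def sum_distrib_left sum_distrib_right ac_simps)

lemma D2_minus_left: "D2 z (- P) Q = - D2 z P Q"
  using D2_scale_left[of z "-1"] by simp

lemma D3_minus_left: "D3 z (- P) Q R = - D3 z P Q R"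
  by (simp add: D3_def sum_negf)

lemma D2_commute: "z \<in> W \<Longrightarrow> D2 z P Q = D2 z Q P"
  unfolding D2_def sum_distrib_right
  by (subst sum.swap) (simp add: partial2_commute ac_simps)

lemma D3_commute12: "z \<in> W \<Longrightarrow> D3 z P Q R = D3 z Q P R"
  unfolding D3_def sum_distrib_right
proof (rule sum.cong[OF refl])
  fix k assume z: "z \<in> W"
  show "(\<Sum>j\<in>UNIV. \<Sum>i\<in>UNIV. partial i (partial j (partial k C)) z * P $ i * Q $ j * R $ k) =
      (\<Sum>j\<in>UNIV. \<Sum>i\<in>UNIV. partial i (partial j (partial k C)) z * Q $ i * P $ j * R $ k)"
    using z by (subst sum.swap) (simp add: partial3_commute12[of z _ _ k] ac_simps)
qed

lemma D3_commute23: "z \<in> W \<Longrightarrow> D3 z P Q R = D3 z P R Q"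
  unfolding D3_def sum_distrib_right
  by (subst sum.swap) (simp add: partial3_commute23 ac_simps)

text \<open>This is \<open>geodesic_identity\<close> contracted with \<open>R\<close>. The vectors
  \<open>v\<close> and \<open>R\<close> lie in different factors, and \<open>b\<close> says in which
  one \<open>R\<close> lies: \<open>False\<close> serves horizontal geodesics, \<open>True\<close>
  vertical ones.\<close>

lemma D2_geodesic:
  assumes "z \<in> W" "\<And>k. (if isl k = b then v $ k = 0 else R $ k = 0)"
  shows "D2 z (\<Gamma> z v) R = D3 z v v R"
  unfolding D2_def D3_def
proof (rule sum.cong[OF refl])
  fix n
  show "(\<Sum>i\<in>UNIV. partial i (partial n C) z * \<Gamma> z v $ i) * R $ n =
      (\<Sum>j\<in>UNIV. (\<Sum>i\<in>UNIV. partial i (partial j (partial n C)) z * v $ i) * v $ j) * R $ n"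
  proof (cases "isl n = b")
    case True
    then have "v $ k = 0" if "isl k = isl n" for k using assms(2)[of k] that by simp
    then have "(\<Sum>i\<in>UNIV. partial i (partial n C) z * \<Gamma> z v $ i) =
      (\<Sum>i\<in>UNIV. \<Sum>j\<in>UNIV. partial i (partial j (partial n C)) z * v $ i * v $ j)"
      by (rule geodesic_identity[OF assms(1)])
    also have "\<dots> = (\<Sum>j\<in>UNIV. (\<Sum>i\<in>UNIV. partial i (partial j (partial n C)) z * v $ i) * v $ j)"
      unfolding sum_distrib_right by (rule sum.swap)
    finally show ?thesis by simp
  next
    case False
    then show ?thesis using assms(2)[of n] by simp
  qed
qed

text \<open>The bracket is the derivative of \<open>D3 z P Q Q\<close> along a horizontal geodesic
  with velocity \<open>P\<close> and constant \<open>Q\<close>. This is how curvature enters the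
  second-order comparison.\<close>

lemma sec_eq_D4:
  assumes "z \<in> W" "\<And>k. \<not> isl k \<Longrightarrow> P $ k = 0" "\<And>k. isl k \<Longrightarrow> Q $ k = 0"
  shows "sec g z P Q = - (D4 z P P Q Q - D3 z (\<Gamma> z P) Q Q) / 2"
proof -
  have "D4 z P P Q Q = (\<Sum>j\<in>UNIV. \<Sum>l\<in>UNIV. (\<Sum>i\<in>UNIV. \<Sum>k\<in>UNIV.
           partial i (partial k (partial j (partial l C))) z * P $ i * P $ k) * Q $ j * Q $ l)"
    unfolding D4_def sum_distrib_right
    by (rule trans[OF sum.swap], rule sum.cong[OF refl], rule sum.cong[OF refl], rule sum.swap)
  moreover have
    "D3 z (\<Gamma> z P) Q Q
    = (\<Sum>j\<in>UNIV. \<Sum>l\<in>UNIV. (\<Sum>m\<in>UNIV. partial m (partial j (partial l C)) z * \<Gamma> z P $ m) * Q $ j * Q $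
    l)"
    unfolding D3_def sum_distrib_right by (rule sum.swap)
  ultimately show ?thesis using sec_mixed[OF assms] by simp
qed

text \<open>The two off-diagonal blocks contribute equally, so the metric evaluated on
  \<open>P + Q\<close> is \<open>- D2 z P Q\<close>.\<close>

lemma null_vector_iff_D2:
  assumes "z \<in> W" "\<And>k. \<not> isl k \<Longrightarrow> P $ k = 0" "\<And>k. isl k \<Longrightarrow> Q $ k = 0"
  shows "null_vector (g z) (P + Q) \<longleftrightarrow> D2 z P Q = 0"
proof -
  have "(P + Q) \<bullet> (g z *v (P + Q)) = (\<Sum>i\<in>UNIV. \<Sum>j\<in>UNIV. (P + Q) $ i * g z $ i $ j * (P + Q) $ j)"
    by (simp add: inner_vec_def matrix_vector_mult_def sum_distrib_left mult.assoc)
  also have "\<dots> = (\<Sum>i\<in>UNIV. \<Sum>j\<in>UNIV. - (partial i (partial j C) z * P $ i * Q $ j) / 2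
      - (partial j (partial i C) z * P $ j * Q $ i) / 2)"
  proof (intro sum.cong refl)
    fix i j
    show "(P + Q) $ i * g z $ i $ j * (P + Q) $ j = - (partial i (partial j C) z * P $ i * Q $ j) /
      2
      - (partial j (partial i C) z * P $ j * Q $ i) / 2"
      using assms partial2_commute[OF assms(1), of i j]
      by (cases "isl i"; cases "isl j") (auto simp: g_eq)
  qed
  also have "\<dots> = - D2 z P Q / 2 - D2 z P Q / 2"
    unfolding sum_subtractf sum_divide_distrib[symmetric] sum_negf D2_def sum_distrib_right
    by (subst sum.swap) simp
  finally show ?thesis by (simp add: null_vector_def)
qed

text \<open>Testing with coordinate vectors kills the unbarred rows of \<open>g z\<close> applied to
  \<open>Q\<close>; the barred rows vanish because \<open>Q\<close> is barred, and
  \<open>g z\<close> is invertible.\<close>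

lemma D2_nondegenerate:
  assumes "z \<in> W" "\<And>k. isl k \<Longrightarrow> Q $ k = 0" "\<And>R. (\<And>k. \<not> isl k \<Longrightarrow> R $ k = 0) \<Longrightarrow> D2 z R Q = 0"
  shows "Q = 0"
proof -
  have "Q $ m = 0" for m
  proof (rule g_kernel[OF assms(1)])
    fix n
    show "(\<Sum>m\<in>UNIV. g z $ n $ m * Q $ m) = 0"
    proof (cases "isl n")
      case True
      have "g z $ n $ m * Q $ m = - (partial n (partial m C) z * Q $ m) / 2" for m
        using assms(1,2) True by (cases "isl m") (auto simp: g_eq)
      moreover have "D2 z (axis n 1) Q = (\<Sum>m\<in>UNIV. partial n (partial m C) z * Q $ m)"
        by (simp add: D2_def axis_def if_distrib[of "\<lambda>x. _ * x"] cong: if_cong)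
      moreover have "D2 z (axis n 1) Q = 0" using True by (intro assms(3)) (auto simp: axis_def)
      ultimately show ?thesis by (simp add: sum_negf sum_divide_distrib[symmetric])
    next
      case False
      then show ?thesis using assms(1,2) by (intro sum.neutral) (auto simp: g_eq)
    qed
  qed
  then show ?thesis by (simp add: vec_eq_iff)
qed

lemma isCont_D1: "z \<in> W \<Longrightarrow> isCont (\<lambda>z. D1 z P) z"
  unfolding D1_def
  by (intro continuous_intros differentiable_imp_continuous_within differentiable_partial)

lemma isCont_D2:
  assumes "isCont \<zeta> p" "\<zeta> p \<in> W" "isCont P p" "isCont Q p"
  shows "isCont (\<lambda>p. D2 (\<zeta> p) (P p) (Q p)) p"
  unfolding D2_def using assms
  by (intro continuous_intros isCont_o2[OF assms(1)] differentiable_imp_continuous_within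
    differentiable_partial2)

text \<open>When \<open>Q\<close> and \<open>B\<close> are velocity and acceleration of the vertical
  curve, \<open>D1 (\<zeta> s) Q\<close> and \<open>D2 (\<zeta> s) Q Q + D1 (\<zeta> s) B\<close>
  are the first and second derivatives of the cost in the vertical parameter. The conclusions supply
  the data that \<open>second_order_comparison\<close> asks for.\<close>

lemma horizontal_geodesic_DERIV:
  assumes s: "s \<in> {0..1}" "\<zeta> s \<in> W" "geodesic_equation_at g \<zeta> s"
    and const: "\<forall>\<^sub>F s' in at s within {0..1}. \<forall>k. \<not> isl k \<longrightarrow> \<zeta> s' $ k = \<zeta> s $ k"
    and Q: "\<And>k. isl k \<Longrightarrow> Q $ k = 0" and B: "\<And>k. isl k \<Longrightarrow> B $ k = 0"
  obtains v d1 d2 where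
    "\<And>k. \<not> isl k \<Longrightarrow> v $ k = 0"
    "\<forall>\<^sub>F s' in nhds s. s' \<in> {0..1} \<longrightarrow> ((\<lambda>s. D1 (\<zeta> s) Q) has_real_derivative d1 s')
      (at s' within {0..1})"
    "\<forall>\<^sub>F s' in nhds s. s' \<in> {0..1} \<longrightarrow> ((\<lambda>s. D2 (\<zeta> s) Q Q + D1 (\<zeta> s) B) has_real_derivative d2 s')
      (at s' within {0..1})"
    "(d1 has_real_derivative 0) (at s within {0..1})"
    "(d2 has_real_derivative - 2 * sec g (\<zeta> s) v Q) (at s within {0..1})"
    "d1 s = D2 (\<zeta> s) v Q"
    "d2 s = D3 (\<zeta> s) v Q Q + D2 (\<zeta> s) v B"
proof -
  obtain v where ev:
    "\<forall>\<^sub>F s' in nhds s. s' \<in> {0..1} \<longrightarrow> (\<zeta> has_vector_derivative v s') (at s' within {0..1})"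
    and v': "(v has_vector_derivative - \<Gamma> (\<zeta> s) (v s)) (at s within {0..1})"
  proof -
    have *: "- \<Gamma> z w = (\<chi> m. - (\<Sum>i\<in>UNIV. \<Sum>j\<in>UNIV. christoffel g m i j z * w $ i * w $ j))" for z w
      by (simp add: \<Gamma>_def vec_eq_iff)
    show ?thesis using s(3) that unfolding geodesic_equation_at_def *[symmetric] by blast
  qed
  have \<zeta>': "(\<zeta> has_vector_derivative v s) (at s within {0..1})"
    using eventually_nhds_x_imp_x[OF ev] s(1) by simp
  have "\<forall>\<^sub>F s' in at s within {0..1}. \<zeta> s' \<in> W"
    using has_vector_derivative_continuous[OF \<zeta>'] s(2) open_W
    by (auto simp: continuous_within tendsto_def)
  then have evW: "\<forall>\<^sub>F s' in nhds s. s' \<in> {0..1} \<longrightarrow> \<zeta> s' \<in> W"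
    unfolding eventually_at_filter by eventually_elim (use s in auto)
  \<comment> \<open>The barred coordinates are constant along the curve, so the velocity has no
    barred part.\<close>
  have v0: "v s $ k = 0" if "\<not> isl k" for k
  proof (rule has_field_derivative_unique)
    show "((\<lambda>s. \<zeta> s $ k) has_real_derivative v s $ k) (at s within {0..1})"
      by (rule DERIV_vec_nth[OF \<zeta>'])
    show "((\<lambda>s. \<zeta> s $ k) has_real_derivative 0) (at s within {0..1})"
      using const that
      by (subst has_field_derivative_cong_eventually[where g="\<lambda>_. \<zeta> s $ k"])
        (auto elim: eventually_mono)
    show "at s within {0..1} \<noteq> bot"
      using s(1) by (intro at_within_Icc_neq_bot) auto
  qed
  define d1 where "d1 s = D2 (\<zeta> s) (v s) Q" for s
  define d2 where "d2 s = D3 (\<zeta> s) (v s) Q Q + D2 (\<zeta> s) (v s) B" for s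
  have \<Gamma>_R: "D2 (\<zeta> s) (\<Gamma> (\<zeta> s) (v s)) R = D3 (\<zeta> s) (v s) (v s) R" if "\<And>k. isl k \<Longrightarrow> R $ k = 0" for R
    using that v0 by (intro D2_geodesic[where b=False] s) auto
  show ?thesis
  proof (rule that)
    show "\<forall>\<^sub>F s' in nhds s. s' \<in> {0..1} \<longrightarrow> ((\<lambda>s. D1 (\<zeta> s) Q) has_real_derivative d1 s')
      (at s' within {0..1})"
      using ev evW
    proof eventually_elim
      case (elim s')
      then show ?case using DERIV_D1[of \<zeta> s' "v s'" "{0..1}" "\<lambda>_. Q" 0] by (simp add: d1_def D1_def)
    qed
    show "\<forall>\<^sub>F s' in nhds s. s' \<in> {0..1} \<longrightarrow> ((\<lambda>s. D2 (\<zeta> s) Q Q + D1 (\<zeta> s) B) has_real_derivative d2 s')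
      (at s' within {0..1})"
      using ev evW
    proof eventually_elim
      case (elim s')
      then show ?case
        using DERIV_add[OF DERIV_D2[of \<zeta> s' "v s'" "{0..1}" "\<lambda>_. Q" 0 "\<lambda>_. Q" 0]
          DERIV_D1[of \<zeta> s' "v s'" "{0..1}" "\<lambda>_. B" 0]]
        by (simp add: d2_def D1_def D2_def)
    qed
    \<comment> \<open>By \<open>D2_geodesic\<close> the acceleration cancels the third-derivative
      term. With \<open>R = Q\<close> this makes the first function affine; with
      \<open>R = B\<close> it removes the acceleration term from the derivative of
      \<open>d2\<close>, where only curvature is left.\<close>
    have D2': "((\<lambda>s. D2 (\<zeta> s) (v s) R) has_real_derivative 0) (at s within {0..1})"
      if "\<And>k. isl k \<Longrightarrow> R $ k = 0" for R
      using DERIV_D2[OF s(2) \<zeta>' v', of "\<lambda>_. R" 0] \<Gamma>_R[OF that]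
        by (simp add: D2_minus_left) (simp add: D2_def)
    then show "(d1 has_real_derivative 0) (at s within {0..1})"
      unfolding d1_def[abs_def] using Q by blast
    have "sec g (\<zeta> s) (v s) Q = - (D4 (\<zeta> s) (v s) (v s) Q Q - D3 (\<zeta> s) (\<Gamma> (\<zeta> s) (v s)) Q Q) / 2"
      using Q v0 by (intro sec_eq_D4 s)
    then have "D4 (\<zeta> s) (v s) (v s) Q Q - D3 (\<zeta> s) (\<Gamma> (\<zeta> s) (v s)) Q Q = - 2 * sec g (\<zeta> s) (v s) Q"
      by simp
    then show "(d2 has_real_derivative - 2 * sec g (\<zeta> s) (v s) Q) (at s within {0..1})"
      unfolding d2_def[abs_def]
      using DERIV_add[OF DERIV_D3[OF s(2) \<zeta>' v', of Q Q] D2'[OF B]]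
        by (simp only: D3_minus_left) simp
  qed (use v0 in \<open>auto simp: d1_def d2_def\<close>)
qed

end

section \<open>Passing between the two manifolds and their coordinates\<close>

section \<open>Charts\<close>

lemma oplus_nth [simp]: "(p \<oplus>\<^sub>v q) $ Inl i = p $ i" "(p \<oplus>\<^sub>v q) $ Inr j = q $ j"
  by (simp_all add: oplus_def)

lemma vec_sum_eq_iff:
  "(u::real^('n::finite + 'n)) = w \<longleftrightarrow> (\<forall>i. u $ Inl i = w $ Inl i) \<and> (\<forall>j. u $ Inr j = w $ Inr j)"
  unfolding vec_eq_iff by (metis sum.exhaust)

lemma oplus_eq_iff [simp]: "p \<oplus>\<^sub>v q = p' \<oplus>\<^sub>v q' \<longleftrightarrow> p = p' \<and> q = q'"
  by (simp add: vec_sum_eq_iff) (simp add: vec_eq_iff)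

lemma oplus_split: "p \<oplus>\<^sub>v q = (p \<oplus>\<^sub>v 0) + (0 \<oplus>\<^sub>v q)"
  by (simp add: vec_sum_eq_iff)

definition unbarred :: "real^('n::finite + 'n) \<Rightarrow> real^'n" where "unbarred z = (\<chi> i. z $ Inl i)"
definition barred :: "real^('n::finite + 'n) \<Rightarrow> real^'n" where "barred z = (\<chi> j. z $ Inr j)"

lemma unbarred_oplus [simp]: "unbarred (p \<oplus>\<^sub>v q) = p" and barred_oplus [simp]: "barred (p \<oplus>\<^sub>v q) = q"
  by (simp_all add: unbarred_def barred_def vec_eq_iff)

lemma oplus_unbarred_barred [simp]: "unbarred z \<oplus>\<^sub>v barred z = z"
  by (simp add: unbarred_def barred_def vec_sum_eq_iff)

lemma bounded_linear_unbarred: "bounded_linear (unbarred :: real^('n::finite + 'n) \<Rightarrow> _)"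
  and bounded_linear_barred: "bounded_linear (barred :: real^('n::finite + 'n) \<Rightarrow> _)"
  unfolding linear_conv_bounded_linear[symmetric]
  by (auto intro!: linearI simp: unbarred_def barred_def vec_eq_iff)

lemma bounded_linear_oplus_left: "bounded_linear (\<lambda>p :: real^'n::finite. p \<oplus>\<^sub>v 0)"
  and bounded_linear_oplus_right: "bounded_linear (\<lambda>q :: real^'n::finite. 0 \<oplus>\<^sub>v q)"
  unfolding linear_conv_bounded_linear[symmetric]
  by (auto intro!: linearI simp: vec_sum_eq_iff)

lemma has_vector_derivative_oplus:
  fixes a b :: "real \<Rightarrow> real^'n::finite"
  assumes "(a has_vector_derivative a') F" "(b has_vector_derivative b') F"
  shows "((\<lambda>s. a s \<oplus>\<^sub>v b s) has_vector_derivative a' \<oplus>\<^sub>v b') F"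
  using has_vector_derivative_add[OF bounded_linear.has_vector_derivative[OF
    bounded_linear_oplus_left assms(1)]
    bounded_linear.has_vector_derivative[OF bounded_linear_oplus_right assms(2)]]
  by (simp add: oplus_split[symmetric])

lemma isCont_oplus:
  fixes a b :: "'c::t2_space \<Rightarrow> real^'n::finite"
  assumes "isCont a t" "isCont b t"
  shows "isCont (\<lambda>s. a s \<oplus>\<^sub>v b s) t"
  using continuous_add[OF bounded_linear.continuous[OF bounded_linear_oplus_left assms(1)]
    bounded_linear.continuous[OF bounded_linear_oplus_right assms(2)]]
  by (simp add: oplus_split[symmetric])

locale cost_geometry =
  fixes M :: "'a::metric_space set" and A :: "('a set \<times> ('a \<Rightarrow> real^'n::finite)) set"
    and M' :: "'b::metric_space set" and A' :: "('b set \<times> ('b \<Rightarrow> real^'n)) set"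
    and N :: "('a \<times> 'b) set" and c :: "'a \<times> 'b \<Rightarrow> ereal"
  assumes atlas: "smooth_atlas M A" "smooth_atlas M' A'"
    and openin_N: "openin (top_of_set (M \<times> M')) N"
    and weakly_regular: "weakly_regular A A' N c"
begin

lemma N_subset: "N \<subseteq> M \<times> M'"
  using openin_N by (rule openin_imp_subset)

lemma chart_at: "y \<in> M \<Longrightarrow> \<exists>U \<phi>. (U, \<phi>) \<in> A \<and> y \<in> U"
  and chart_at': "y' \<in> M' \<Longrightarrow> \<exists>V \<psi>. (V, \<psi>) \<in> A' \<and> y' \<in> V"
  using atlas unfolding smooth_atlas_def by auto

lemma
  assumes "(U, \<phi>) \<in> A"
  shows openin_chart: "openin (top_of_set M) U" and open_chart_image: "open (\<phi> ` U)"
    and homeomorphism_chart: "homeomorphism U (\<phi> ` U) \<phi> (inv_into U \<phi>)"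
  using atlas(1) assms unfolding smooth_atlas_def by auto

lemma
  assumes "(V, \<psi>) \<in> A'"
  shows openin_chart': "openin (top_of_set M') V" and open_chart_image': "open (\<psi> ` V)"
    and homeomorphism_chart': "homeomorphism V (\<psi> ` V) \<psi> (inv_into V \<psi>)"
  using atlas(2) assms unfolding smooth_atlas_def by auto

lemma inv_chart: "(U, \<phi>) \<in> A \<Longrightarrow> y \<in> U \<Longrightarrow> inv_into U \<phi> (\<phi> y) = y"
  using homeomorphism_apply1[OF homeomorphism_chart] by blast

lemma inv_chart': "(V, \<psi>) \<in> A' \<Longrightarrow> y \<in> V \<Longrightarrow> inv_into V \<psi> (\<psi> y) = y"
  using homeomorphism_apply1[OF homeomorphism_chart'] by blast

context
  fixes U \<phi> V \<psi>
  assumes charts: "(U, \<phi>) \<in> A" "(V, \<psi>) \<in> A'"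
begin

lemma local_cost_oplus:
  "y \<in> U \<Longrightarrow> y' \<in> V \<Longrightarrow> local_cost c U \<phi> V \<psi> (\<phi> y \<oplus>\<^sub>v \<psi> y') = real_of_ereal (c (y, y'))"
  using inv_chart[OF charts(1)] inv_chart'[OF charts(2)] by (simp add: local_cost_def)

lemma chart_imageI: "(y, y') \<in> N \<Longrightarrow> y \<in> U \<Longrightarrow> y' \<in> V \<Longrightarrow> \<phi> y \<oplus>\<^sub>v \<psi> y' \<in> chart_image N U \<phi> V \<psi>"
  unfolding chart_image_def by force

text \<open>Turns coordinates back into points, which is needed once \<open>y\<close> is moved in
  coordinates.\<close>

lemma chart_imageE:
  assumes "p \<oplus>\<^sub>v \<psi> y' \<in> chart_image N U \<phi> V \<psi>" "y' \<in> V"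
  obtains y where "y \<in> U" "(y, y') \<in> N" "p = \<phi> y"
proof -
  obtain y y'' where y: "(y, y'') \<in> N" "y \<in> U" "y'' \<in> V" "p = \<phi> y" "\<psi> y' = \<psi> y''"
    using assms(1) unfolding chart_image_def by auto
  have "y'' = y'" using y inv_chart'[OF charts(2) \<open>y'' \<in> V\<close>] inv_chart'[OF charts(2) assms(2)]
    by metis
  with y show ?thesis using that by blast
qed

text \<open>The image is the preimage of \<open>N\<close> under the inverse product chart
  \<open>\<kappa>\<close>, which is continuous on the open set \<open>O'\<close>.\<close>

lemma open_chart_image_product: "open (chart_image N U \<phi> V \<psi>)"
proof -
  define O' where "O' = {z. unbarred z \<in> \<phi> ` U \<and> barred z \<in> \<psi> ` V}"
  define \<kappa> where "\<kappa> z = (inv_into U \<phi> (unbarred z), inv_into V \<psi> (barred z))" for z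
  have cont: "continuous_on S unbarred" "continuous_on S barred" for S :: "(real^('n + 'n)) set"
    by (simp_all add: linear_continuous_on bounded_linear_unbarred bounded_linear_barred)
  have "O' = (unbarred -` (\<phi> ` U)) \<inter> (barred -` (\<psi> ` V))" by (auto simp: O'_def)
  then have "open O'"
    using open_chart_image[OF charts(1)] open_chart_image'[OF charts(2)] cont
    by (auto intro!: open_Int open_vimage)
  moreover have "continuous_on O' \<kappa>"
    unfolding \<kappa>_def
    by (intro continuous_on_Pair continuous_on_compose2[OF
      homeomorphism_cont2[OF homeomorphism_chart[OF charts(1)]]]
       continuous_on_compose2[OF homeomorphism_cont2[OF homeomorphism_chart'[OF charts(2)]]] cont)
      (auto simp: O'_def)
  moreover have \<kappa>_in: "\<kappa> z \<in> U \<times> V" if "z \<in> O'" for z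
    using that by (auto simp: \<kappa>_def O'_def inv_into_into)
  moreover have "U \<subseteq> M" "V \<subseteq> M'"
    using openin_chart[OF charts(1)] openin_chart'[OF charts(2)] openin_imp_subset by blast+
  moreover obtain T where T: "open T" "N = (M \<times> M') \<inter> T"
    using openin_N by (auto simp: openin_open)
  moreover have "chart_image N U \<phi> V \<psi> = O' \<inter> \<kappa> -` N"
  proof (intro set_eqI iffI)
    fix z assume "z \<in> O' \<inter> \<kappa> -` N"
    then have z: "z \<in> O'" "\<kappa> z \<in> N" by auto
    have "unbarred z = \<phi> (fst (\<kappa> z))" "barred z = \<psi> (snd (\<kappa> z))"
      using z(1) by (auto simp: O'_def \<kappa>_def f_inv_into_f)
    then have "z = \<phi> (fst (\<kappa> z)) \<oplus>\<^sub>v \<psi> (snd (\<kappa> z))" by (metis oplus_unbarred_barred)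
    with z \<kappa>_in[OF z(1)] show "z \<in> chart_image N U \<phi> V \<psi>"
      using chart_imageI[of "fst (\<kappa> z)" "snd (\<kappa> z)"] by (metis mem_Times_iff prod.collapse)
  next
    fix z assume "z \<in> chart_image N U \<phi> V \<psi>"
    then show "z \<in> O' \<inter> \<kappa> -` N"
      unfolding chart_image_def using inv_chart[OF charts(1)] inv_chart'[OF charts(2)]
      by (auto simp: O'_def \<kappa>_def)
  qed
  \<comment> \<open>\<open>N\<close> is open only relative to \<open>M \<times> M'\<close>. Since
    \<open>\<kappa>\<close> takes its values there, the ambient open set \<open>T\<close> may stand
    in for \<open>N\<close>.\<close>
  moreover have "O' \<inter> \<kappa> -` N = O' \<inter> \<kappa> -` T"
  proof -
    have "\<kappa> z \<in> M \<times> M'" if "z \<in> O'" for z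
      using \<kappa>_in[OF that] \<open>U \<subseteq> M\<close> \<open>V \<subseteq> M'\<close> by (meson Sigma_mono subsetD)
    then have "z \<in> O' \<inter> \<kappa> -` N \<longleftrightarrow> z \<in> O' \<inter> \<kappa> -` T" for z
      unfolding T(2) Int_iff vimage_eq by metis
    then show ?thesis by blast
  qed
  ultimately show ?thesis by (simp add: continuous_open_preimage)
qed

lemma chart_metric:
  "off_diagonal_metric (chart_image N U \<phi> V \<psi>) (local_cost c U \<phi> V \<psi>) (cost_metric c U \<phi> V \<psi>)"
proof
  show "open (chart_image N U \<phi> V \<psi>)" by (rule open_chart_image_product)
  show C4: "Ck_on 4 (local_cost c U \<phi> V \<psi>) (chart_image N U \<phi> V \<psi>)"
    using weakly_regular charts unfolding weakly_regular_def cost_Ck_def by blast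
  fix z assume z: "z \<in> chart_image N U \<phi> V \<psi>"
  \<comment> \<open>\<open>cross_matrix\<close> fixes one order of differentiation for both blocks,
    whereas the locale uses the order of the indices.\<close>
  have comm: "partial k (partial l (local_cost c U \<phi> V \<psi>)) z
    = partial l (partial k (local_cost c U \<phi> V \<psi>)) z" for k l
    by (rule partial_commute[OF open_chart_image_product _ z]) (rule Ck_on_mono[OF _ C4], simp)
  show "cost_metric c U \<phi> V \<psi> z $ k $ l =
      (if isl k = isl l then 0 else - partial k (partial l (local_cost c U \<phi> V \<psi>)) z / 2)" for k l
    by (cases k; cases l) (auto simp: cost_metric_def cross_matrix_def comm)
  let ?B = "cross_matrix c U \<phi> V \<psi> z"
  have inv: "invertible ?B"
    using weakly_regular charts z unfolding weakly_regular_def nondegenerate_def by blast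
  have "v = 0" if v: "cost_metric c U \<phi> V \<psi> z *v v = 0" for v
  proof -
    have split: "(\<Sum>l\<in>UNIV. f l) = (\<Sum>i\<in>UNIV. f (Inl i)) + (\<Sum>j\<in>UNIV. f (Inr j))"
      for f :: "'n + 'n \<Rightarrow> real"
      by (simp add: UNIV_Plus_UNIV[symmetric] sum.Plus del: UNIV_Plus_UNIV)
    have eq: "(\<Sum>l\<in>UNIV. cost_metric c U \<phi> V \<psi> z $ k $ l * v $ l) = 0" for k
      using v by (simp add: vec_eq_iff matrix_vector_mult_def)
    \<comment> \<open>The unbarred rows of the metric apply the cross matrix to the barred part of
      \<open>v\<close>, the barred rows apply its transpose to the unbarred part; both matrices are
      injective.\<close>
    have "(\<Sum>j\<in>UNIV. ?B $ i $ j * v $ Inr j) = 0" for i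
      using eq[of "Inl i"] unfolding split
      by (simp add: cost_metric_def sum_negf sum_divide_distrib[symmetric] flip: minus_divide_left)
    then have "?B *v barred v = 0"
      by (simp add: vec_eq_iff matrix_vector_mult_def barred_def)
    then have 1: "barred v = 0" using inv
      by (metis invertible_left_inverse matrix_left_invertible_ker)
    have "(\<Sum>i\<in>UNIV. ?B $ i $ j * v $ Inl i) = 0" for j
      using eq[of "Inr j"] unfolding split
      by (simp add: cost_metric_def sum_negf sum_divide_distrib[symmetric] flip: minus_divide_left)
    then have "transpose ?B *v unbarred v = 0"
      by (simp add: vec_eq_iff matrix_vector_mult_def unbarred_def transpose_def)
    then have 2: "unbarred v = 0" using inv
      by (metis invertible_left_inverse matrix_left_invertible_ker transpose_invertible)
    have "v = 0 \<oplus>\<^sub>v 0" by (metis 1 2 oplus_unbarred_barred)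
    then show ?thesis by (simp add: vec_sum_eq_iff)
  qed
  then show "invertible (cost_metric c U \<phi> V \<psi> z)"
    by (simp add: invertible_left_inverse matrix_left_invertible_ker)
qed

end

end

section \<open>Comparing the cost along a vertical geodesic from \<open>x\<close> and from other
  points\<close>

section \<open>Sliding mountains\<close>

locale sliding_mountain = cost_geometry M A M' A' N c
  for M :: "'a::metric_space set" and A :: "('a set \<times> ('a \<Rightarrow> real^'n::finite)) set"
    and M' :: "'b::metric_space set" and A' :: "('b set \<times> ('b \<Rightarrow> real^'n)) set"
    and N :: "('a \<times> 'b) set" and c :: "'a \<times> 'b \<Rightarrow> ereal" +
  fixes x :: 'a and \<xi> :: "real \<Rightarrow> 'b"
  assumes horizontally_convex: "horizontally_convex A M' A' N c"
    and geodesic_\<xi>: "geodesic A A' N c (\<lambda>t. (x, \<xi> t))"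
begin

text \<open>Real-valued so that it can be differentiated; it is faithful where the cost is finite,
  in particular while \<open>(y, \<xi> t)\<close> lies in \<open>N\<close>. The mountain that slides
  with \<open>t\<close> is \<open>F x t - F y t\<close>, seen as a function of
  \<open>y\<close>.\<close>

definition F :: "'a \<Rightarrow> real \<Rightarrow> real" where "F y t = real_of_ereal (c (y, \<xi> t))"

definition J :: "'b set \<Rightarrow> real set" where "J V = {t \<in> {0<..<1}. \<xi> t \<in> V}"

lemma x_\<xi>_in_N: "t \<in> {0<..<1} \<Longrightarrow> (x, \<xi> t) \<in> N"
  using geodesic_\<xi> by (simp add: geodesic_def)

lemma continuous_on_\<xi>: "continuous_on {0..1} \<xi>"
  using continuous_on_snd[of "{0..1}" "\<lambda>t. (x, \<xi> t)"] geodesic_\<xi>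
    by (simp add: geodesic_def path_def)

lemma \<xi>_in_M': "t \<in> {0<..<1} \<Longrightarrow> \<xi> t \<in> M'"
  using x_\<xi>_in_N N_subset by blast

lemma x_in_M: "x \<in> M"
  using x_\<xi>_in_N[of "1/2"] N_subset by auto

lemma open_J:
  assumes "(V, \<psi>) \<in> A'"
  shows "open (J V)"
proof -
  have "continuous_on {0<..<1} \<xi>"
    by (rule continuous_on_subset[OF continuous_on_\<xi>]) auto
  then have "openin (top_of_set {0<..<1}) ({0<..<1} \<inter> \<xi> -` V)"
    using \<xi>_in_M' by (intro continuous_openin_preimage[OF _ _ openin_chart'[OF assms]]) auto
  moreover have "J V = {0<..<1} \<inter> \<xi> -` V" by (auto simp: J_def)
  ultimately show ?thesis by (simp add: openin_open_eq)
qed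

lemma open_domain:
  assumes "y \<in> M"
  shows "open {t \<in> {0<..<1}. (y, \<xi> t) \<in> N}"
proof -
  have "continuous_on {0<..<1} (\<lambda>t. (y, \<xi> t))"
    by (intro continuous_intros continuous_on_subset[OF continuous_on_\<xi>]) auto
  then have "openin (top_of_set {0<..<1}) ({0<..<1} \<inter> (\<lambda>t. (y, \<xi> t)) -` N)"
    using \<xi>_in_M' assms by (intro continuous_openin_preimage[OF _ _ openin_N]) auto
  moreover have "{t \<in> {0<..<1}. (y, \<xi> t) \<in> N} = {0<..<1} \<inter> (\<lambda>t. (y, \<xi> t)) -` N" by auto
  ultimately show ?thesis by (simp add: openin_open_eq)
qed

text \<open>Velocity and acceleration in the chart \<open>\<psi>\<close> alone, so that the same
  vectors can be used over every \<open>y\<close>.\<close>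

abbreviation \<xi>1 :: "('b \<Rightarrow> real^'n) \<Rightarrow> real \<Rightarrow> real^'n" where
  "\<xi>1 \<psi> t \<equiv> vector_derivative (\<lambda>s. \<psi> (\<xi> s)) (at t)"

abbreviation \<xi>2 :: "('b \<Rightarrow> real^'n) \<Rightarrow> real \<Rightarrow> real^'n" where
  "\<xi>2 \<psi> t \<equiv> vector_derivative (\<xi>1 \<psi>) (at t)"

text \<open>Replaces the velocity field hidden in the geodesic equation by the canonical
  \<open>\<xi>1\<close> and \<open>\<xi>2\<close>. The acceleration is governed by the connection at
  \<open>x\<close>, which is why the comparison later starts with slope 0 exactly there.\<close>

lemma vertical_geodesic:
  assumes "(U, \<phi>) \<in> A" "(V, \<psi>) \<in> A'" "x \<in> U" "t \<in> J V"
  shows "((\<lambda>s. \<psi> (\<xi> s)) has_vector_derivative \<xi>1 \<psi> t) (at t)"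
    and "(\<xi>1 \<psi> has_vector_derivative \<xi>2 \<psi> t) (at t)"
    and "0 \<oplus>\<^sub>v \<xi>2 \<psi> t = - off_diagonal_metric.\<Gamma> (cost_metric c U \<phi> V \<psi>) (\<phi> x \<oplus>\<^sub>v \<psi> (\<xi> t))
      (0 \<oplus>\<^sub>v \<xi>1 \<psi> t)"
proof -
  interpret off_diagonal_metric "chart_image N U \<phi> V \<psi>" "local_cost c U \<phi> V \<psi>"
    "cost_metric c U \<phi> V \<psi>"
    by (rule chart_metric[OF assms(1,2)])
  define \<zeta> where "\<zeta> s = \<phi> x \<oplus>\<^sub>v \<psi> (\<xi> s)" for s
  have t: "t \<in> {0<..<1}" "\<xi> t \<in> V" using assms(4) by (auto simp: J_def)
  have within: "at s within {0..1} = at s" if "s \<in> {0<..<1}" for s :: real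
    using that by (intro at_within_interior) auto
  have "geodesic_equation_at (cost_metric c U \<phi> V \<psi>) \<zeta> t"
    using geodesic_\<xi> assms t x_\<xi>_in_N[OF t(1)] unfolding geodesic_def \<zeta>_def by fastforce
  moreover have
    "- \<Gamma> z w = (\<chi> m. - (\<Sum>i\<in>UNIV. \<Sum>j\<in>UNIV. christoffel (cost_metric c U \<phi> V \<psi>) m i j z * w $ i * w $
    j))" for z w
    by (simp add: \<Gamma>_def vec_eq_iff)
  ultimately obtain v where
    v: "\<forall>\<^sub>F s in nhds t. s \<in> {0..1} \<longrightarrow> (\<zeta> has_vector_derivative v s) (at s within {0..1})" and
    v': "(v has_vector_derivative - \<Gamma> (\<zeta> t) (v t)) (at t)"
    unfolding geodesic_equation_at_def within[OF t(1)] by auto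
  have "\<forall>\<^sub>F s in nhds t. s \<in> {0<..<1}" using t by (intro eventually_nhds_in_open) auto
  with v have v_at: "\<forall>\<^sub>F s in nhds t. (\<zeta> has_vector_derivative v s) (at s)"
    by eventually_elim (use within in force)
  have barred_\<zeta>: "(\<lambda>s. barred (\<zeta> s)) = (\<lambda>s. \<psi> (\<xi> s))" by (simp add: \<zeta>_def)
  have der: "\<forall>\<^sub>F s in nhds t. ((\<lambda>s. \<psi> (\<xi> s)) has_vector_derivative barred (v s)) (at s)"
    using v_at by eventually_elim
      (use bounded_linear.has_vector_derivative[OF bounded_linear_barred, of \<zeta>] barred_\<zeta> in auto)
  then have ev1: "\<forall>\<^sub>F s in nhds t. \<xi>1 \<psi> s = barred (v s)"
    by eventually_elim (rule vector_derivative_at)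
  \<comment> \<open>The first coordinate of the curve is constantly \<open>\<phi> x\<close>, so the
    velocity is purely barred.\<close>
  have ev2: "\<forall>\<^sub>F s in nhds t. 0 \<oplus>\<^sub>v \<xi>1 \<psi> s = v s"
    using v_at ev1
  proof eventually_elim
    case (elim s)
    have "((\<lambda>s. unbarred (\<zeta> s)) has_vector_derivative unbarred (v s)) (at s)"
      by (rule bounded_linear.has_vector_derivative[OF bounded_linear_unbarred elim(1)])
    then have "unbarred (v s) = 0"
      using vector_derivative_unique_at[of "\<lambda>_. \<phi> x" "unbarred (v s)" s 0] by (simp add: \<zeta>_def)
    then show ?case using oplus_unbarred_barred[of "v s"] elim by simp
  qed
  show *: "((\<lambda>s. \<psi> (\<xi> s)) has_vector_derivative \<xi>1 \<psi> t) (at t)"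
    using eventually_nhds_x_imp_x[OF der] eventually_nhds_x_imp_x[OF ev1] by simp
  have "((\<lambda>s. barred (v s)) has_vector_derivative barred (- \<Gamma> (\<zeta> t) (v t))) (at t)"
    by (rule bounded_linear.has_vector_derivative[OF bounded_linear_barred v'])
  then have "(\<xi>1 \<psi> has_vector_derivative barred (- \<Gamma> (\<zeta> t) (v t))) (at t)"
    using has_vector_derivative_cong_ev[where S=UNIV and x=t and f="\<xi>1 \<psi>" and g="\<lambda>s. barred (v s)"]
      ev1 eventually_nhds_x_imp_x[OF ev1] by simp
  then show 2: "(\<xi>1 \<psi> has_vector_derivative \<xi>2 \<psi> t) (at t)"
    by (metis vector_derivative_at)
  have "((\<lambda>s. 0 \<oplus>\<^sub>v \<xi>1 \<psi> s) has_vector_derivative 0 \<oplus>\<^sub>v \<xi>2 \<psi> t) (at t)"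
    by (intro has_vector_derivative_oplus 2 has_vector_derivative_const)
  then have "(v has_vector_derivative 0 \<oplus>\<^sub>v \<xi>2 \<psi> t) (at t)"
    using has_vector_derivative_cong_ev[where S=UNIV and x=t and f="\<lambda>s. 0 \<oplus>\<^sub>v \<xi>1 \<psi> s" and g=v]
      ev2 eventually_nhds_x_imp_x[OF ev2] by simp
  then show "0 \<oplus>\<^sub>v \<xi>2 \<psi> t = - \<Gamma> (\<phi> x \<oplus>\<^sub>v \<psi> (\<xi> t)) (0 \<oplus>\<^sub>v \<xi>1 \<psi> t)"
    using vector_derivative_unique_at[OF _ v'] eventually_nhds_x_imp_x[OF ev2] by (simp add: \<zeta>_def)
qed

lemma
  assumes "(U, \<phi>) \<in> A" "(V, \<psi>) \<in> A'" "y \<in> U" "t \<in> J V" "(y, \<xi> t) \<in> N"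
  shows DERIV_F: "(F y has_real_derivative
      off_diagonal_metric.D1 (local_cost c U \<phi> V \<psi>) (\<phi> y \<oplus>\<^sub>v \<psi> (\<xi> t)) (0 \<oplus>\<^sub>v \<xi>1 \<psi> t)) (at t)"
    and DERIV_deriv_F: "(deriv (F y) has_real_derivative
      off_diagonal_metric.D2 (local_cost c U \<phi> V \<psi>) (\<phi> y \<oplus>\<^sub>v \<psi> (\<xi> t)) (0 \<oplus>\<^sub>v \<xi>1 \<psi> t) (0 \<oplus>\<^sub>v \<xi>1 \<psi> t)
      + off_diagonal_metric.D1 (local_cost c U \<phi> V \<psi>) (\<phi> y \<oplus>\<^sub>v \<psi> (\<xi> t)) (0 \<oplus>\<^sub>v \<xi>2 \<psi> t)) (at t)"
proof -
  interpret off_diagonal_metric "chart_image N U \<phi> V \<psi>" "local_cost c U \<phi> V \<psi>"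
    "cost_metric c U \<phi> V \<psi>"
    by (rule chart_metric[OF assms(1,2)])
  \<comment> \<open>The geodesic lives over \<open>x\<close>, so the derivatives of
    \<open>\<xi>\<close> come from a chart at \<open>x\<close>, while the cost is expressed in a
    chart at \<open>y\<close>.\<close>
  obtain U0 \<phi>0 where U0: "(U0, \<phi>0) \<in> A" "x \<in> U0" using chart_at[OF x_in_M] by blast
  note \<xi>' = vertical_geodesic[OF U0(1) assms(2) U0(2)]
  define \<zeta> where "\<zeta> s = \<phi> y \<oplus>\<^sub>v \<psi> (\<xi> s)" for s
  \<comment> \<open>An open set of parameters on which the formula for the first derivative holds,
    so that it may be differentiated once more.\<close>
  define T where "T = J V \<inter> {t \<in> {0<..<1}. (y, \<xi> t) \<in> N}"
  have "y \<in> M" using assms(5) N_subset by blast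
  then have "open T" unfolding T_def by (intro open_Int open_J[OF assms(2)] open_domain)
  moreover have "t \<in> T" using assms(4,5) by (auto simp: T_def J_def)
  ultimately have T: "open T" "t \<in> T" .
  have \<zeta>: "\<zeta> s \<in> chart_image N U \<phi> V \<psi>" "(\<zeta> has_vector_derivative 0 \<oplus>\<^sub>v \<xi>1 \<psi> s) (at s)" if "s \<in> T"
    for s
  proof -
    show "\<zeta> s \<in> chart_image N U \<phi> V \<psi>" unfolding \<zeta>_def
      using that assms by (intro chart_imageI) (auto simp: T_def J_def)
    show "(\<zeta> has_vector_derivative 0 \<oplus>\<^sub>v \<xi>1 \<psi> s) (at s)"
      unfolding \<zeta>_def[abs_def] using that
      by (intro has_vector_derivative_oplus \<xi>' has_vector_derivative_const) (auto simp: T_def)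
  qed
  have F_eq: "local_cost c U \<phi> V \<psi> (\<zeta> s) = F y s" if "s \<in> T" for s
    unfolding \<zeta>_def F_def using that assms by (intro local_cost_oplus) (auto simp: T_def J_def)
  have der: "(F y has_real_derivative D1 (\<zeta> s) (0 \<oplus>\<^sub>v \<xi>1 \<psi> s)) (at s)" if "s \<in> T" for s
    using has_field_derivative_transform_within_open[OF DERIV_C[OF \<zeta>[OF that]] T(1) that F_eq] .
  show "(F y has_real_derivative D1 (\<phi> y \<oplus>\<^sub>v \<psi> (\<xi> t)) (0 \<oplus>\<^sub>v \<xi>1 \<psi> t)) (at t)"
    using der[OF T(2)] by (simp add: \<zeta>_def)
  have "((\<lambda>s. 0 \<oplus>\<^sub>v \<xi>1 \<psi> s) has_vector_derivative 0 \<oplus>\<^sub>v \<xi>2 \<psi> t) (at t)"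
    by (intro has_vector_derivative_oplus has_vector_derivative_const \<xi>' assms)
  from DERIV_D1[OF \<zeta>[OF T(2)] this]
  have "(deriv (F y) has_real_derivative D2 (\<zeta> t) (0 \<oplus>\<^sub>v \<xi>1 \<psi> t) (0 \<oplus>\<^sub>v \<xi>1 \<psi> t)
    + D1 (\<zeta> t) (0 \<oplus>\<^sub>v \<xi>2 \<psi> t)) (at t)"
    by (rule has_field_derivative_transform_within_open[OF _ T]) (simp add: DERIV_imp_deriv[OF der])
  then show "(deriv (F y) has_real_derivative D2 (\<phi> y \<oplus>\<^sub>v \<psi> (\<xi> t)) (0 \<oplus>\<^sub>v \<xi>1 \<psi> t) (0 \<oplus>\<^sub>v \<xi>1 \<psi> t)
      + D1 (\<phi> y \<oplus>\<^sub>v \<psi> (\<xi> t)) (0 \<oplus>\<^sub>v \<xi>2 \<psi> t)) (at t)"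
    by (simp add: \<zeta>_def)
qed

text \<open>\<open>second_order_comparison\<close> is applied along a horizontal geodesic
  \<open>a\<close> from \<open>x\<close> to \<open>y\<close>, with the first and second
  \<open>t\<close>-derivatives of \<open>F (a s)\<close> as its two functions.\<close>

lemma deriv_deriv_F_le:
  assumes t: "t \<in> {0<..<1}" and y: "(y, \<xi> t) \<in> N" and eq: "deriv (F y) t = deriv (F x) t"
  shows "deriv (deriv (F y)) t \<le> deriv (deriv (F x)) t"
proof (cases "y = x")
  \<comment> \<open>\<open>geodesically_convex\<close> links only distinct points, hence the case
    distinction.\<close>
  case False
  obtain V \<psi> where V: "(V, \<psi>) \<in> A'" "\<xi> t \<in> V" using chart_at'[OF \<xi>_in_M'[OF t]] by blast
  have tJ: "t \<in> J V" using t V by (simp add: J_def)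
  have "geodesically_convex A A' N c (section_left N (\<xi> t) \<times> {\<xi> t})"
    using horizontally_convex \<xi>_in_M'[OF t]
      by (simp add: horizontally_convex_def appears_convex_left_def)
  moreover have "(x, \<xi> t) \<in> section_left N (\<xi> t) \<times> {\<xi> t}" "(y, \<xi> t) \<in> section_left N (\<xi> t) \<times> {\<xi> t}"
    using y x_\<xi>_in_N[OF t] by (auto simp: section_left_def)
  ultimately obtain \<gamma> where \<gamma>: "geodesic A A' N c \<gamma>" "pathstart \<gamma> = (x, \<xi> t)"
    "pathfinish \<gamma> = (y, \<xi> t)"
    "path_image \<gamma> \<subseteq> section_left N (\<xi> t) \<times> {\<xi> t}"
    using False unfolding geodesically_convex_def by (metis prod.inject)
  define a where "a s = fst (\<gamma> s)" for s
  have \<gamma>_eq: "\<gamma> s = (a s, \<xi> t)" and \<gamma>_N: "(a s, \<xi> t) \<in> N" if "s \<in> {0..1}" for s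
  proof -
    have "\<gamma> s \<in> section_left N (\<xi> t) \<times> {\<xi> t}" using \<gamma>(4) that unfolding path_image_def by blast
    then show "\<gamma> s = (a s, \<xi> t)" "(a s, \<xi> t) \<in> N" by (auto simp: a_def section_left_def prod_eq_iff)
  qed
  have cont_a: "continuous_on {0..1} a"
    using \<gamma>(1) unfolding a_def[abs_def] geodesic_def path_def by (intro continuous_intros) auto
  have a01: "a 0 = x" "a 1 = y" using \<gamma>(2,3) by (auto simp: a_def pathstart_def pathfinish_def)
  define Q where "Q = 0 \<oplus>\<^sub>v \<xi>1 \<psi> t"
  define B where "B = 0 \<oplus>\<^sub>v \<xi>2 \<psi> t"
  have QB: "isl k \<Longrightarrow> Q $ k = 0" "isl k \<Longrightarrow> B $ k = 0" for k
    by (auto simp: Q_def B_def isl_def)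
  have "deriv (deriv (F (a 1))) t \<le> deriv (deriv (F (a 0))) t"
  proof (rule second_order_comparison)
    show "deriv (F (a 0)) t = deriv (F (a 1)) t" using eq a01 by simp
    fix s :: real assume s: "s \<in> {0..1}"
    have "a s \<in> M" using \<gamma>_N[OF s] N_subset by blast
    then obtain U \<phi> where U: "(U, \<phi>) \<in> A" "a s \<in> U" "s = 0 \<longrightarrow> x \<in> U" using chart_at a01 by metis
    interpret off_diagonal_metric "chart_image N U \<phi> V \<psi>" "local_cost c U \<phi> V \<psi>"
      "cost_metric c U \<phi> V \<psi>"
      by (rule chart_metric[OF U(1) V(1)])
    define \<zeta> where "\<zeta> s = \<phi> (fst (\<gamma> s)) \<oplus>\<^sub>v \<psi> (snd (\<gamma> s))" for s
    have \<zeta>_eq: "\<zeta> s' = \<phi> (a s') \<oplus>\<^sub>v \<psi> (\<xi> t)" if "s' \<in> {0..1}" for s'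
      using \<gamma>_eq[OF that] by (simp add: \<zeta>_def)
    have \<zeta>W: "\<zeta> s \<in> chart_image N U \<phi> V \<psi>"
      unfolding \<zeta>_eq[OF s] using \<gamma>_N[OF s] U V by (intro chart_imageI)
    have geo: "geodesic_equation_at (cost_metric c U \<phi> V \<psi>) \<zeta> s"
      using \<gamma>(1) s \<gamma>_eq[OF s] \<gamma>_N[OF s] U V unfolding geodesic_def \<zeta>_def by fastforce
    have const: "\<forall>\<^sub>F s' in at s within {0..1}. \<forall>k. \<not> isl k \<longrightarrow> \<zeta> s' $ k = \<zeta> s $ k"
      unfolding eventually_at_filter
    proof (intro always_eventually allI impI)
      fix s' :: real and k :: "'n + 'n" assume "s' \<in> {0..1}" "\<not> isl k"
      then show "\<zeta> s' $ k = \<zeta> s $ k" using s by (cases k) (auto simp: \<zeta>_eq)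
    qed
    obtain v d1 d2 where v: "\<And>k. \<not> isl k \<Longrightarrow> v $ k = 0"
      "\<forall>\<^sub>F s' in nhds s. s' \<in> {0..1} \<longrightarrow> ((\<lambda>s. D1 (\<zeta> s) Q) has_real_derivative d1 s')
        (at s' within {0..1})"
      "\<forall>\<^sub>F s' in nhds s. s' \<in> {0..1} \<longrightarrow> ((\<lambda>s. D2 (\<zeta> s) Q Q + D1 (\<zeta> s) B) has_real_derivative d2 s')
        (at s' within {0..1})"
      "(d1 has_real_derivative 0) (at s within {0..1})"
      "(d2 has_real_derivative - 2 * sec (cost_metric c U \<phi> V \<psi>) (\<zeta> s) v Q) (at s within {0..1})"
      "d1 s = D2 (\<zeta> s) v Q"
      "d2 s = D3 (\<zeta> s) v Q Q + D2 (\<zeta> s) v B"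
      by (rule horizontal_geodesic_DERIV[OF s \<zeta>W geo const]) (erule QB(1), erule QB(2), rule that)
    have evU: "\<forall>\<^sub>F s' in nhds s. s' \<in> {0..1} \<longrightarrow> a s' \<in> U"
    proof -
      have "openin (top_of_set {0..1}) ({0..1} \<inter> a -` U)"
        using \<gamma>_N N_subset by (intro continuous_openin_preimage[OF cont_a _ openin_chart[OF U(1)]])
          blast
      then obtain T where T: "open T" "{0..1} \<inter> a -` U = {0..1} \<inter> T" by (auto simp: openin_open)
      then have "s \<in> T" using U(2) s by blast
      then have "\<forall>\<^sub>F s' in nhds s. s' \<in> T" using T(1) by (rule eventually_nhds_in_open[rotated])
      then show ?thesis by eventually_elim (use T(2) in blast)
    qed
    have H_eq: "deriv (F (a s')) t = D1 (\<zeta> s') Q"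
      "deriv (deriv (F (a s'))) t = D2 (\<zeta> s') Q Q + D1 (\<zeta> s') B" if "s' \<in> {0..1}" "a s' \<in> U" for s'
      using DERIV_imp_deriv[OF DERIV_F[OF U(1) V(1) that(2) tJ \<gamma>_N[OF that(1)]]]
        DERIV_imp_deriv[OF DERIV_deriv_F[OF U(1) V(1) that(2) tJ \<gamma>_N[OF that(1)]]]
      by (simp_all add: \<zeta>_eq[OF that(1)] Q_def B_def)
    have "\<forall>\<^sub>F s' in nhds s. s' \<in> {0..1} \<longrightarrow> ((\<lambda>s. deriv (F (a s)) t) has_real_derivative d1 s')
      (at s' within {0..1})"
      \<comment> \<open>Transferring a derivative to \<open>s'\<close> needs the coordinate formula
        on a whole neighbourhood of \<open>s'\<close>, hence the iterated eventuality.\<close>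
      using v(2) evU[THEN eventually_eventually[THEN iffD2]]
    proof eventually_elim
      case (elim s')
      show ?case
      proof
        assume s': "s' \<in> {0..1}"
        have "\<forall>\<^sub>F r in nhds s'. r \<in> {0..1} \<longrightarrow> deriv (F (a r)) t = D1 (\<zeta> r) Q"
          using elim(2) by eventually_elim (use H_eq in blast)
        from has_field_derivative_cong_ev[OF refl this refl refl s'] elim(1) s'
        show "((\<lambda>s. deriv (F (a s)) t) has_real_derivative d1 s') (at s' within {0..1})" by blast
      qed
    qed
    moreover have
      "\<forall>\<^sub>F s' in nhds s. s' \<in> {0..1} \<longrightarrow> ((\<lambda>s. deriv (deriv (F (a s))) t) has_real_derivative d2 s')
      (at s' within {0..1})"
      using v(3) evU[THEN eventually_eventually[THEN iffD2]]
    proof eventually_elim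
      case (elim s')
      show ?case
      proof
        assume s': "s' \<in> {0..1}"
        have "\<forall>\<^sub>F r in nhds s'. r \<in> {0..1} \<longrightarrow> deriv (deriv (F (a r))) t = D2 (\<zeta> r) Q Q + D1 (\<zeta> r) B"
          using elim(2) by eventually_elim (use H_eq in blast)
        from has_field_derivative_cong_ev[OF refl this refl refl s'] elim(1) s'
        show "((\<lambda>s. deriv (deriv (F (a s))) t) has_real_derivative d2 s') (at s' within {0..1})"
          by blast
      qed
    qed
    \<comment> \<open>A vanishing \<open>d1 s\<close> says that horizontal and vertical velocity
      together form a null vector, and weak regularity then gives the sign of the curvature.\<close>
    moreover have "d1 s = 0 \<longrightarrow> - 2 * sec (cost_metric c U \<phi> V \<psi>) (\<zeta> s) v Q \<le> 0"
    proof
      assume "d1 s = 0"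
      then have "null_vector (cost_metric c U \<phi> V \<psi> (\<zeta> s)) (v + Q)"
        using null_vector_iff_D2[OF \<zeta>W v(1) QB(1)] v(6) by simp
      moreover have "v = unbarred v \<oplus>\<^sub>v 0"
        using v(1) by (simp add: vec_sum_eq_iff unbarred_def)
      moreover have "v + Q = unbarred v \<oplus>\<^sub>v \<xi>1 \<psi> t"
        using v(1) by (simp add: vec_sum_eq_iff unbarred_def Q_def)
      moreover have "\<And>p p'. null_vector (cost_metric c U \<phi> V \<psi> (\<zeta> s)) (p \<oplus>\<^sub>v p') \<Longrightarrow>
        sec (cost_metric c U \<phi> V \<psi>) (\<zeta> s) (p \<oplus>\<^sub>v 0) (0 \<oplus>\<^sub>v p') \<ge> 0"
        using weakly_regular U(1) V(1) \<zeta>W unfolding weakly_regular_def by fast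
      ultimately have "sec (cost_metric c U \<phi> V \<psi>) (\<zeta> s) v Q \<ge> 0"
        unfolding Q_def by metis
      then show "- 2 * sec (cost_metric c U \<phi> V \<psi>) (\<zeta> s) v Q \<le> 0" by simp
    qed
    \<comment> \<open>Over \<open>x\<close> the vertical curve is a geodesic, so \<open>B\<close> is
      \<open>- \<Gamma> (\<zeta> s) Q\<close>, and \<open>D2_geodesic\<close> turns the acceleration
      term into the negative of the third-derivative term.\<close>
    moreover have "s = 0 \<longrightarrow> d2 s = 0"
    proof
      assume s0: "s = 0"
      then have "\<zeta> s = \<phi> x \<oplus>\<^sub>v \<psi> (\<xi> t)" using \<zeta>_eq[OF s] a01 by simp
      then have B: "B = - \<Gamma> (\<zeta> s) Q"
        using vertical_geodesic(3)[OF U(1) V(1) _ tJ] U(3) s0 by (simp add: B_def Q_def)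
      have "D2 (\<zeta> s) v B = D2 (\<zeta> s) B v" by (rule D2_commute[OF \<zeta>W])
      also have "\<dots> = - D2 (\<zeta> s) (\<Gamma> (\<zeta> s) Q) v" by (simp add: B D2_minus_left)
      also have "\<dots> = - D3 (\<zeta> s) Q Q v"
        using QB v(1) by (subst D2_geodesic[OF \<zeta>W, where b=True]) auto
      also have "D3 (\<zeta> s) Q Q v = D3 (\<zeta> s) v Q Q"
        using D3_commute12[OF \<zeta>W] D3_commute23[OF \<zeta>W] by metis
      finally show "d2 s = 0" by (simp add: v(7))
    qed
    ultimately show "\<exists>d1 d2 e.
      (\<forall>\<^sub>F s' in nhds s. s' \<in> {0..1} \<longrightarrow> ((\<lambda>s. deriv (F (a s)) t) has_real_derivative d1 s')
        (at s' within {0..1})) \<and>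
      (\<forall>\<^sub>F s' in nhds s. s' \<in> {0..1} \<longrightarrow> ((\<lambda>s. deriv (deriv (F (a s))) t) has_real_derivative d2 s')
        (at s' within {0..1})) \<and>
      (d1 has_real_derivative 0) (at s within {0..1}) \<and>
      (d2 has_real_derivative e) (at s within {0..1}) \<and>
      (d1 s = 0 \<longrightarrow> e \<le> 0) \<and> (s = 0 \<longrightarrow> d2 s = 0)"
      using v(4,5)
      by (intro exI[of _ d1] exI[of _ d2] exI[of _ "- 2 * sec (cost_metric c U \<phi> V \<psi>) (\<zeta> s) v Q"]
        conjI)
  qed
  then show ?thesis by (simp add: a01)
qed simp

text \<open>For every fixed horizontal \<open>R\<close>, the pairing
  \<open>D2 (\<zeta> s) (Q s) R\<close> is conserved along the geodesic. It is 0 at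
  \<open>t\<close>, so nondegeneracy makes the velocity vanish nearby. This settles the case in
  which no direction for moving \<open>y\<close> exists.\<close>

lemma geodesic_eventually_constant:
  assumes t: "t \<in> {0<..<1}" and V: "(V, \<psi>) \<in> A'" "\<xi> t \<in> V" and "\<xi>1 \<psi> t = 0"
  shows "\<forall>\<^sub>F s in nhds t. \<xi> s = \<xi> t"
proof -
  have tJ: "t \<in> J V" using t V by (simp add: J_def)
  obtain d where d: "d > 0" "ball t d \<subseteq> J V"
    using open_J[OF V(1)] tJ open_contains_ball by blast
  obtain U \<phi> where U: "(U, \<phi>) \<in> A" "x \<in> U" using chart_at[OF x_in_M] by blast
  interpret off_diagonal_metric "chart_image N U \<phi> V \<psi>" "local_cost c U \<phi> V \<psi>"
    "cost_metric c U \<phi> V \<psi>"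
    by (rule chart_metric[OF U(1) V(1)])
  define \<zeta> where "\<zeta> s = \<phi> x \<oplus>\<^sub>v \<psi> (\<xi> s)" for s
  define Q where "Q s = 0 \<oplus>\<^sub>v \<xi>1 \<psi> s" for s
  note \<xi>' = vertical_geodesic[OF U(1) V(1) U(2)]
  have \<zeta>: "\<zeta> s \<in> chart_image N U \<phi> V \<psi>" "(\<zeta> has_vector_derivative Q s) (at s)"
    "(Q has_vector_derivative - \<Gamma> (\<zeta> s) (Q s)) (at s)" if "s \<in> J V" for s
  proof -
    show "\<zeta> s \<in> chart_image N U \<phi> V \<psi>" unfolding \<zeta>_def
      using that U V x_\<xi>_in_N by (intro chart_imageI) (auto simp: J_def)
    show "(\<zeta> has_vector_derivative Q s) (at s)"
      unfolding \<zeta>_def[abs_def] Q_def using that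
      by (intro has_vector_derivative_oplus \<xi>' has_vector_derivative_const)
    have "((\<lambda>s. 0 \<oplus>\<^sub>v \<xi>1 \<psi> s) has_vector_derivative 0 \<oplus>\<^sub>v \<xi>2 \<psi> s) (at s)"
      using that by (intro has_vector_derivative_oplus \<xi>' has_vector_derivative_const)
    then show "(Q has_vector_derivative - \<Gamma> (\<zeta> s) (Q s)) (at s)"
      unfolding \<zeta>_def Q_def[abs_def] using \<xi>'(3)[OF that] by simp
  qed
  have Q0: "isl k \<Longrightarrow> Q s $ k = 0" for k s by (auto simp: Q_def isl_def)
  have "\<xi>1 \<psi> s = 0" if s: "s \<in> ball t d" for s
  proof -
    have sJ: "s \<in> J V" using s d by blast
    have "Q s = 0"
    proof (rule D2_nondegenerate[OF \<zeta>(1)[OF sJ] Q0])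
      fix R :: "real^('n + 'n)" assume R: "\<And>k. \<not> isl k \<Longrightarrow> R $ k = 0"
      have "((\<lambda>s. D2 (\<zeta> s) (Q s) R) has_real_derivative 0) (at r within ball t d)" if "r \<in> ball t d"
        for r
      proof -
        have rJ: "r \<in> J V" using that d by blast
        have "D2 (\<zeta> r) (\<Gamma> (\<zeta> r) (Q r)) R = D3 (\<zeta> r) (Q r) (Q r) R"
          using Q0 R by (intro D2_geodesic[where b=True] \<zeta>(1) rJ) auto
        moreover have "D2 (\<zeta> r) (Q r) 0 = 0" by (simp add: D2_def)
        ultimately have "((\<lambda>s. D2 (\<zeta> s) (Q s) R) has_real_derivative 0) (at r)"
          using DERIV_D2[OF \<zeta>(1,2)[OF rJ] \<zeta>(3)[OF rJ], of "\<lambda>_. R" 0] by (simp add: D2_minus_left)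
        then show ?thesis by (rule has_field_derivative_at_within)
      qed
      then obtain k where k: "\<And>r. r \<in> ball t d \<Longrightarrow> D2 (\<zeta> r) (Q r) R = k"
        using has_field_derivative_zero_constant[OF convex_ball, of t d "\<lambda>s. D2 (\<zeta> s) (Q s) R"]
          by blast
      have "Q t = 0" using assms(4) by (simp add: Q_def vec_sum_eq_iff)
      then have "k = 0" using k[of t] d(1) by (simp add: D2_def)
      then show "D2 (\<zeta> s) R (Q s) = 0" using k[OF s] D2_commute[OF \<zeta>(1)[OF sJ]] by metis
    qed
    then have "0 \<oplus>\<^sub>v \<xi>1 \<psi> s = 0 \<oplus>\<^sub>v 0" by (simp add: Q_def vec_sum_eq_iff)
    then show ?thesis by simp
  qed
  \<comment> \<open>Zero velocity makes the coordinates constant on the ball, and the chart is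
    injective.\<close>
  then have "((\<lambda>s. \<psi> (\<xi> s)) has_vector_derivative 0) (at s within ball t d)" if "s \<in> ball t d" for s
    using \<xi>'(1)[of s] that d(2) by (metis has_vector_derivative_at_within subsetD)
  then obtain k where k: "\<And>s. s \<in> ball t d \<Longrightarrow> \<psi> (\<xi> s) = k"
    using has_vector_derivative_zero_constant[OF convex_ball, of t d "\<lambda>s. \<psi> (\<xi> s)"] by blast
  have "\<xi> s = \<xi> t" if "s \<in> ball t d" for s
  proof -
    have "\<psi> (\<xi> s) = \<psi> (\<xi> t)" "\<xi> s \<in> V" using k[OF that] k[of t] that d by (auto simp: J_def)
    then show ?thesis using inv_chart'[OF V(1)] V(2) by metis
  qed
  moreover have "\<forall>\<^sub>F s in nhds t. s \<in> ball t d" using d(1) by (intro eventually_nhds_in_open) auto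
  ultimately show ?thesis by (simp add: eventually_mono)
qed

lemma critical_point_is_local_min:
  assumes t: "t \<in> {0<..<1}" and y: "(y, \<xi> t) \<in> N" and eq: "deriv (F y) t = deriv (F x) t"
  shows "\<forall>\<^sub>F s in nhds t. F x t - F y t \<le> F x s - F y s"
proof -
  obtain V \<psi> where V: "(V, \<psi>) \<in> A'" "\<xi> t \<in> V" using chart_at'[OF \<xi>_in_M'[OF t]] by blast
  have tJ: "t \<in> J V" using t V by (simp add: J_def)
  have "y \<in> M" using y N_subset by blast
  then obtain U \<phi> where U: "(U, \<phi>) \<in> A" "y \<in> U" using chart_at by blast
  obtain U0 \<phi>0 where U0: "(U0, \<phi>0) \<in> A" "x \<in> U0" using chart_at[OF x_in_M] by blast
  note \<xi>' = vertical_geodesic[OF U0(1) V(1) U0(2)]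
  interpret off_diagonal_metric "chart_image N U \<phi> V \<psi>" "local_cost c U \<phi> V \<psi>"
    "cost_metric c U \<phi> V \<psi>"
    by (rule chart_metric[OF U(1) V(1)])
  define Q where "Q s = 0 \<oplus>\<^sub>v \<xi>1 \<psi> s" for s
  have Q0: "isl k \<Longrightarrow> Q s $ k = 0" for k s by (auto simp: Q_def isl_def)
  show ?thesis
  proof (cases "\<xi>1 \<psi> t = 0")
    \<comment> \<open>Near \<open>t\<close> the curve, and hence both cost functions, are
      constant.\<close>
    case True
    from geodesic_eventually_constant[OF t V True] show ?thesis by eventually_elim (simp add: F_def)
  next
    case False
    have W_t: "\<phi> y \<oplus>\<^sub>v \<psi> (\<xi> t) \<in> chart_image N U \<phi> V \<psi>" using y U V by (intro chart_imageI)
    have "Q t \<noteq> 0" using False by (auto simp: Q_def vec_sum_eq_iff vec_eq_iff)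
    then obtain R where R: "\<And>k. \<not> isl k \<Longrightarrow> R $ k = 0" "D2 (\<phi> y \<oplus>\<^sub>v \<psi> (\<xi> t)) R (Q t) \<noteq> 0"
      using D2_nondegenerate[OF W_t Q0] by blast
    \<comment> \<open>Nondegeneracy provides a direction that pairs nontrivially with the velocity;
      its sign is chosen to make the pairing negative.\<close>
    define w where "w = - sgn (D2 (\<phi> y \<oplus>\<^sub>v \<psi> (\<xi> t)) R (Q t)) *\<^sub>R unbarred R"
    have "w \<oplus>\<^sub>v 0 = - sgn (D2 (\<phi> y \<oplus>\<^sub>v \<psi> (\<xi> t)) R (Q t)) *\<^sub>R R"
      using R(1) by (simp add: w_def vec_sum_eq_iff unbarred_def)
    then have w: "D2 (\<phi> y \<oplus>\<^sub>v \<psi> (\<xi> t)) (w \<oplus>\<^sub>v 0) (Q t) < 0"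
      using R(2) by (simp add: D2_scale_left D2_minus_left sgn_mult_self_eq abs_sgn[symmetric])
        (simp add: sgn_if split: if_splits)
    \<comment> \<open>The first parameter moves along \<open>\<xi>\<close>, the second displaces
      \<open>y\<close> along \<open>w\<close> in coordinates. Later the displacement is
      \<open>\<epsilon> * (s - t)\<close>.\<close>
    define z where "z p = (\<phi> y + snd p *\<^sub>R w) \<oplus>\<^sub>v \<psi> (\<xi> (fst p))" for p :: "real \<times> real"
    have z_t: "z (t, 0) = \<phi> y \<oplus>\<^sub>v \<psi> (\<xi> t)" by (simp add: z_def)
    have cont: "isCont (\<lambda>s. \<psi> (\<xi> s)) s" "isCont (\<xi>1 \<psi>) s" if "s \<in> J V" for s
      using \<xi>'(1,2)[OF that] by (auto intro: has_vector_derivative_continuous)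
    have isCont_z: "isCont z (s, r)" if "s \<in> J V" for s r
      unfolding z_def[abs_def] using cont(1)[OF that]
      by (intro isCont_oplus continuous_intros isCont_o2[where f=fst and g="\<lambda>s. \<psi> (\<xi> s)"]) auto
    define h where "h p = D2 (z p) (w \<oplus>\<^sub>v 0) (Q (fst p))" for p
    have cont_h: "isCont h (t, 0)"
      unfolding h_def[abs_def] Q_def using cont(2)[OF tJ] W_t
      by (intro isCont_D2 isCont_z tJ isCont_oplus continuous_intros
        isCont_o2[where f=fst and g="\<xi>1 \<psi>"]) (auto simp: z_t)
    have "h (t, 0) < 0" using w by (simp add: h_def z_t)
    with cont_h have "\<forall>\<^sub>F p in nhds (t, 0). h p < 0"
      by (intro order_tendstoD(2)[OF isCont_tendsto_nhds])
    moreover have "\<forall>\<^sub>F p in nhds (t, 0). z p \<in> chart_image N U \<phi> V \<psi>"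
      using isCont_z[OF tJ, of 0] W_t open_W
      by (intro topological_tendstoD[OF isCont_tendsto_nhds]) (auto simp: z_t)
    moreover have "\<forall>\<^sub>F p in nhds (t, 0::real). fst p \<in> J V"
      using open_J[OF V(1)] tJ by (intro topological_tendstoD[OF tendsto_fst[OF filterlim_ident]])
        auto
    ultimately have "\<forall>\<^sub>F p in nhds (t, 0). h p < 0 \<and> z p \<in> chart_image N U \<phi> V \<psi> \<and> fst p \<in> J V"
      by eventually_elim auto
    then obtain e
      where e: "e > 0" "\<And>p. dist p (t, 0) < e \<Longrightarrow> h p < 0 \<and> z p \<in> chart_image N U \<phi> V \<psi> \<and> fst p \<in> J V"
      unfolding eventually_nhds_metric by blast
    \<comment> \<open>With each of the two parameters off by less than \<open>e / 2\<close>, the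
      distance in the product stays below \<open>e\<close>.\<close>
    define \<delta> where "\<delta> = e / 2"
    have \<delta>: "\<delta> > 0" using e by (simp add: \<delta>_def)
    have box: "h (s, r) < 0" "z (s, r) \<in> chart_image N U \<phi> V \<psi>" "s \<in> J V"
      if "\<bar>s - t\<bar> < \<delta>" "\<bar>r\<bar> < \<delta>" for s r
    proof -
      have "dist (s, r) (t, 0) \<le> \<bar>s - t\<bar> + \<bar>r\<bar>"
        using sqrt_sum_squares_le_sum_abs[of "s - t" r] by (simp add: dist_Pair_Pair dist_real_def)
      then have "dist (s, r) (t, 0) < e" using that by (simp add: \<delta>_def)
      from e(2)[OF this] show "h (s, r) < 0" "z (s, r) \<in> chart_image N U \<phi> V \<psi>" "s \<in> J V" by auto
    qed
    \<comment> \<open>The \<open>t\<close>-derivative of the mountain, evaluated at the displaced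
      point. For positive \<open>\<epsilon>\<close> it is not a derivative along the moving
      family.\<close>
    define \<Psi> where "\<Psi> \<epsilon> s = deriv (F x) s - D1 (z (s, \<epsilon> * (s - t))) (Q s)" for \<epsilon> s
    \<comment> \<open>The total derivative of \<open>\<Psi> \<epsilon>\<close>; the displacement
      contributes the term with \<open>h\<close>.\<close>
    define \<Psi>' where "\<Psi>' \<epsilon> s = deriv (deriv (F x)) s - (D2 (z (s, \<epsilon> * (s - t))) (Q s) (Q s)
        + \<epsilon> * h (s, \<epsilon> * (s - t)) + D1 (z (s, \<epsilon> * (s - t))) (0 \<oplus>\<^sub>v \<xi>2 \<psi> s))" for \<epsilon> s
    have x_der: "(F x has_real_derivative deriv (F x) s) (at s)"
      "(deriv (F x) has_real_derivative deriv (deriv (F x)) s) (at s)" if "s \<in> J V" for s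
      using DERIV_F[OF U0(1) V(1) U0(2) that] DERIV_deriv_F[OF U0(1) V(1) U0(2) that] x_\<xi>_in_N[of s]
        that
      by (auto simp: J_def DERIV_imp_deriv)
    have small: "\<bar>\<epsilon> * (s - t)\<bar> < \<delta>" if "0 \<le> \<epsilon>" "\<epsilon> \<le> 1" "\<bar>s - t\<bar> < \<delta>" for \<epsilon> s
      using mult_right_mono[of \<epsilon> 1 "\<bar>s - t\<bar>"] that by (simp add: abs_mult)
    have \<Psi>_DERIV: "(\<Psi> \<epsilon> has_real_derivative \<Psi>' \<epsilon> s) (at s)"
      if \<epsilon>: "0 \<le> \<epsilon>" "\<epsilon> \<le> 1" and s: "\<bar>s - t\<bar> < \<delta>" for \<epsilon> s
    proof -
      note b = box[OF s small[OF \<epsilon> s]]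
      have Q': "(Q has_vector_derivative 0 \<oplus>\<^sub>v \<xi>2 \<psi> s) (at s)"
        unfolding Q_def[abs_def] using b(3)
        by (intro has_vector_derivative_oplus \<xi>' has_vector_derivative_const)
      have "((\<lambda>s. \<phi> y + (\<epsilon> * (s - t)) *\<^sub>R w) has_vector_derivative \<epsilon> *\<^sub>R w) (at s)"
        by (auto intro!: derivative_eq_intros)
      then have "((\<lambda>s. z (s, \<epsilon> * (s - t))) has_vector_derivative (\<epsilon> *\<^sub>R w) \<oplus>\<^sub>v \<xi>1 \<psi> s) (at s)"
        unfolding z_def fst_conv snd_conv by (intro has_vector_derivative_oplus \<xi>' b(3))
      moreover have "(\<epsilon> *\<^sub>R w) \<oplus>\<^sub>v \<xi>1 \<psi> s = \<epsilon> *\<^sub>R (w \<oplus>\<^sub>v 0) + Q s"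
        by (simp add: Q_def vec_sum_eq_iff)
      ultimately have z':
        "((\<lambda>s. z (s, \<epsilon> * (s - t))) has_vector_derivative \<epsilon> *\<^sub>R (w \<oplus>\<^sub>v 0) + Q s) (at s)" by simp
      from DERIV_diff[OF x_der(2)[OF b(3)] DERIV_D1[where \<zeta>="\<lambda>s. z (s, \<epsilon> * (s - t))",
        OF b(2) z' Q']]
      show ?thesis unfolding \<Psi>_def[abs_def] \<Psi>'_def
        by (simp add: D2_add_left D2_scale_left h_def algebra_simps)
    qed
    \<comment> \<open>Coordinates near those of \<open>y\<close> belong to actual points
      \<open>y'\<close> of the manifold, to which \<open>deriv_deriv_F_le\<close> applies.\<close>
    have at_y: "\<exists>y'. deriv (F y') s = D1 (z (s, r)) (Q s) \<and> (y', \<xi> s) \<in> N \<and>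
        deriv (deriv (F y')) s = D2 (z (s, r)) (Q s) (Q s) + D1 (z (s, r)) (0 \<oplus>\<^sub>v \<xi>2 \<psi> s) \<and>
        (F y' has_real_derivative D1 (z (s, r)) (Q s)) (at s) \<and> (r = 0 \<longrightarrow> y' = y)"
      if "\<bar>s - t\<bar> < \<delta>" "\<bar>r\<bar> < \<delta>" for s r
    proof -
      note b = box[OF that]
      have \<xi>V: "\<xi> s \<in> V" using b(3) by (simp add: J_def)
      obtain y' where y': "y' \<in> U" "(y', \<xi> s) \<in> N" "\<phi> y + r *\<^sub>R w = \<phi> y'"
        using b(2) unfolding z_def fst_conv snd_conv by (rule chart_imageE[OF U(1) V(1) _ \<xi>V])
      have z: "z (s, r) = \<phi> y' \<oplus>\<^sub>v \<psi> (\<xi> s)" by (simp add: z_def y'(3))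
      note der = DERIV_F[OF U(1) V(1) y'(1) b(3) y'(2), folded Q_def z]
        DERIV_deriv_F[OF U(1) V(1) y'(1) b(3) y'(2), folded Q_def z]
      have "r = 0 \<longrightarrow> y' = y" using y' U inv_chart[OF U(1)]
        by (metis add.right_neutral scaleR_zero_left)
      then show ?thesis using der y'(2) DERIV_imp_deriv by blast
    qed
    \<comment> \<open>At a zero of \<open>\<Psi> \<epsilon>\<close> the parameter \<open>s\<close>
      is critical for the displaced point, so the second derivative there is nonnegative and the
      term \<open>- \<epsilon> * h\<close> makes the slope strictly positive.\<close>
    have \<Psi>_pos: "\<Psi>' \<epsilon> s > 0" if \<epsilon>: "0 < \<epsilon>" "\<epsilon> \<le> 1" and s: "\<bar>s - t\<bar> < \<delta>" and 0: "\<Psi> \<epsilon> s = 0" for \<epsilon> s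
    proof -
      have sm: "\<bar>\<epsilon> * (s - t)\<bar> < \<delta>" using small \<epsilon> s by simp
      have s01: "s \<in> {0<..<1}" using box(3)[OF s sm] by (simp add: J_def)
      obtain y' where y': "deriv (F y') s = D1 (z (s, \<epsilon> * (s - t))) (Q s)" "(y', \<xi> s) \<in> N"
        "deriv (deriv (F y')) s = D2 (z (s, \<epsilon> * (s - t))) (Q s) (Q s)
          + D1 (z (s, \<epsilon> * (s - t))) (0 \<oplus>\<^sub>v \<xi>2 \<psi> s)"
        using at_y[OF s sm] by blast
      have "deriv (F y') s = deriv (F x) s" using 0 y'(1) by (simp add: \<Psi>_def)
      from deriv_deriv_F_le[OF s01 y'(2) this] y'(3)
      have "\<Psi>' \<epsilon> s \<ge> - \<epsilon> * h (s, \<epsilon> * (s - t))" by (simp add: \<Psi>'_def)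
      moreover have "\<epsilon> * h (s, \<epsilon> * (s - t)) < 0" using box(1)[OF s sm] \<epsilon> by (simp add: mult_pos_neg)
      ultimately show ?thesis by simp
    qed
    have \<Psi>0: "\<Psi> 0 s = deriv (F x) s - deriv (F y) s"
      "(F y has_real_derivative deriv (F y) s) (at s)" if "\<bar>s - t\<bar> < \<delta>" for s
    proof -
      have "deriv (F y) s = D1 (z (s, 0)) (Q s)"
        "(F y has_real_derivative D1 (z (s, 0)) (Q s)) (at s)"
        using at_y[OF that, of 0] \<delta> by auto
      then show "\<Psi> 0 s = deriv (F x) s - deriv (F y) s"
        "(F y has_real_derivative deriv (F y) s) (at s)"
        by (simp_all add: \<Psi>_def)
    qed
    \<comment> \<open>At \<open>s = t\<close> nothing is displaced, so all these functions share the
      zero \<open>t\<close>.\<close>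
    have \<Psi>_t: "\<Psi> \<epsilon> t = 0" for \<epsilon> using \<Psi>0(1)[of t] eq \<delta> by (simp add: \<Psi>_def)
    have lim: "((\<lambda>\<epsilon>. \<Psi> \<epsilon> s) \<longlongrightarrow> \<Psi> 0 s) (at_right 0)" if s: "\<bar>s - t\<bar> < \<delta>" for s
    proof -
      have b: "z (s, 0) \<in> chart_image N U \<phi> V \<psi>" "s \<in> J V" using box[OF s, of 0] \<delta> by auto
      have "isCont (\<lambda>\<epsilon>. z (s, \<epsilon> * (s - t))) 0"
        by (rule isCont_o2[where f="\<lambda>\<epsilon>. (s, \<epsilon> * (s - t))" and g=z])
          (auto intro!: continuous_intros isCont_z b(2))
      then have "isCont (\<lambda>\<epsilon>. D1 (z (s, \<epsilon> * (s - t))) (Q s)) 0"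
        by (rule isCont_o2[where g="\<lambda>z. D1 z (Q s)"]) (use isCont_D1[OF b(1)] in simp)
      then have "isCont (\<lambda>\<epsilon>. \<Psi> \<epsilon> s) 0" unfolding \<Psi>_def by (intro continuous_intros)
      then show ?thesis by (simp add: isCont_def filterlim_at_split)
    qed
    have ev: "\<forall>\<^sub>F \<epsilon> in at_right 0. 0 < \<epsilon> \<and> \<epsilon> \<le> (1::real)"
      unfolding eventually_at_right_field by (intro exI[of _ 1]) auto
    \<comment> \<open>Strict upward crossing fixes the sign for every small positive
      \<open>\<epsilon>\<close>; the weak inequality survives the limit.\<close>
    have right: "\<Psi> 0 s \<ge> 0" if s: "t < s" "s - t < \<delta>" for s
    proof (rule tendsto_lowerbound[OF lim])
      show "\<forall>\<^sub>F \<epsilon> in at_right 0. 0 \<le> \<Psi> \<epsilon> s"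
        using ev by eventually_elim
          (rule sign_of_upcrossing[OF \<Psi>_DERIV \<Psi>_pos \<Psi>_t s], auto)
    qed (use s in auto)
    have left: "\<Psi> 0 s \<le> 0" if s: "s < t" "t - s < \<delta>" for s
    proof (rule tendsto_upperbound[OF lim])
      show "\<forall>\<^sub>F \<epsilon> in at_right 0. \<Psi> \<epsilon> s \<le> 0"
        using ev by eventually_elim
          (rule sign_of_upcrossing_left[OF \<Psi>_DERIV \<Psi>_pos \<Psi>_t s], auto)
    qed (use s in auto)
    \<comment> \<open>Its derivative is \<open>\<Psi> 0\<close>, which is nonpositive before
      \<open>t\<close> and nonnegative after it.\<close>
    define f where "f s = F x s - F y s" for s
    have f': "(f has_real_derivative \<Psi> 0 s) (at s)" if "\<bar>s - t\<bar> < \<delta>" for s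
      unfolding f_def[abs_def] \<Psi>0(1)[OF that] using box(3)[OF that, of 0] \<delta> 
      by (intro DERIV_diff \<Psi>0(2)[OF that] x_der(1)) auto
    have "f t \<le> f s" if s: "\<bar>s - t\<bar> < \<delta>" for s
    proof (cases "t \<le> s")
      case True
      show ?thesis
      proof (rule DERIV_nonneg_imp_nondecreasing[OF True])
        fix r assume "t \<le> r" "r \<le> s"
        then show "\<exists>k. (f has_real_derivative k) (at r) \<and> 0 \<le> k"
          using f'[of r] right[of r] \<Psi>_t[of 0] s by (cases "r = t") auto
      qed
    next
      case False
      then have "s \<le> t" by simp
      then show ?thesis
      proof (rule DERIV_nonpos_imp_nonincreasing)
        fix r assume "s \<le> r" "r \<le> t"
        then show "\<exists>k. (f has_real_derivative k) (at r) \<and> k \<le> 0"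
          using f'[of r] left[of r] \<Psi>_t[of 0] s False by (cases "r = t") auto
      qed
    qed
    then show ?thesis
      unfolding f_def eventually_nhds_metric dist_real_def using \<delta> by blast
  qed
qed

text \<open>The maximum over \<open>t\<close> is reached at an end point since critical points are
  local minima. The points \<open>(x, \<xi> 0)\<close> and \<open>(x, \<xi> 1)\<close> may lie on
  the boundary of \<open>N\<close>, so finiteness is assumed and continuity is taken from the
  closure.\<close>

lemma double_mountain_above_sliding_mountain:
  assumes y: "\<And>t. t \<in> {0..1} \<Longrightarrow> (y, \<xi> t) \<in> N"
    and fin: "\<And>t. t \<in> {0..1} \<Longrightarrow> \<bar>c (x, \<xi> t)\<bar> \<noteq> \<infinity>"
    and cont: "continuous_on (closure N) c" and t: "t \<in> {0..1}"
  shows "F x t - F y t \<le> max (F x 0 - F y 0) (F x 1 - F y 1)"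
proof -
  have cont_F: "continuous_on {0..1} (F y')" if y': "\<And>t. t \<in> {0..1} \<Longrightarrow> (y', \<xi> t) \<in> closure N"
    "\<And>t. t \<in> {0..1} \<Longrightarrow> \<bar>c (y', \<xi> t)\<bar> \<noteq> \<infinity>" for y'
  proof -
    have "continuous_on {0..1} (\<lambda>t. c (y', \<xi> t))"
      by (rule continuous_on_compose2[OF cont])
        (use y'(1) in \<open>auto intro!: continuous_intros continuous_on_\<xi>\<close>)
    then show ?thesis unfolding F_def[abs_def]
      by (rule continuous_on_compose2[OF continuous_on_real]) (use y'(2) in force)
  qed
  have fin_N: "\<bar>c p\<bar> \<noteq> \<infinity>" if "p \<in> N" for p
    using weakly_regular that by (simp add: weakly_regular_def cost_Ck_def)
  have x_cl: "(x, \<xi> t) \<in> closure N" if "t \<in> {0..1}" for t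
  proof -
    have "continuous_on (closure {0<..<1::real}) (\<lambda>t. (x, \<xi> t))"
      by (auto intro!: continuous_intros continuous_on_\<xi>)
    then have "(\<lambda>t. (x, \<xi> t)) ` closure {0<..<1::real} \<subseteq> closure N"
      using x_\<xi>_in_N by (intro image_closure_subset) (auto intro: subsetD[OF closure_subset])
    then show ?thesis using that by auto
  qed
  have der: "(F y' has_real_derivative deriv (F y') t) (at t)"
    if t: "t \<in> {0<..<1}" and y': "(y', \<xi> t) \<in> N" for y' t
  proof -
    obtain V \<psi> where V: "(V, \<psi>) \<in> A'" "\<xi> t \<in> V" using chart_at'[OF \<xi>_in_M'[OF t]] by blast
    have "y' \<in> M" using y' N_subset by blast
    then obtain U \<phi> where U: "(U, \<phi>) \<in> A" "y' \<in> U" using chart_at by blast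
    have "t \<in> J V" using t V by (simp add: J_def)
    from DERIV_F[OF U(1) V(1) U(2) this y'] show ?thesis by (metis DERIV_imp_deriv)
  qed
  have f': "((\<lambda>t. F x t - F y t) has_real_derivative deriv (F x) t - deriv (F y) t) (at t)"
    if "t \<in> {0<..<1}" for t
    using that y by (intro DERIV_diff der x_\<xi>_in_N) auto
  show ?thesis
  proof (rule le_max_endpoints_if_critical_local_min[OF _ _ _ t])
    show "continuous_on {0..1} (\<lambda>t. F x t - F y t)"
      using fin fin_N y x_cl by (intro continuous_on_diff cont_F)
        (auto intro: subsetD[OF closure_subset])
    fix s :: real assume s: "s \<in> {0<..<1}"
    show "(\<lambda>t. F x t - F y t) differentiable (at s)"
      using f'[OF s] by (auto simp: real_differentiable_def)
    assume "((\<lambda>t. F x t - F y t) has_real_derivative 0) (at s)"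
    then have "deriv (F y) s = deriv (F x) s" using DERIV_unique[OF f'[OF s]] by force
    then show "\<forall>\<^sub>F r in nhds s. F x s - F y s \<le> F x r - F y r"
      using s y by (intro critical_point_is_local_min) auto
  qed
qed

end

section \<open>From the mountain inequality to convexity of the contact set\<close>

section \<open>Contact sets\<close>

lemma geodesic_equation_at_cong:
  assumes "geodesic_equation_at g \<zeta> t" "\<And>s. s \<in> {0..1} \<Longrightarrow> \<zeta>' s = \<zeta> s" "t \<in> {0..1}"
  shows "geodesic_equation_at g \<zeta>' t"
proof -
  have *: "(\<forall>\<^sub>F s in nhds t. s \<in> {0..1} \<longrightarrow> (\<zeta> has_vector_derivative v s) (at s within {0..1})) \<Longrightarrow>
      (\<forall>\<^sub>F s in nhds t. s \<in> {0..1} \<longrightarrow> (\<zeta>' has_vector_derivative v s) (at s within {0..1}))" for v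
    by (erule eventually_mono) (use assms(2) has_vector_derivative_transform in blast)
  show ?thesis
    using assms(1) * unfolding geodesic_equation_at_def assms(2)[OF assms(3)] by blast
qed

text \<open>The curve provided by convexity is known to have first component \<open>x\<close> only
  on \<open>[0,1]\<close>; this permits replacing it by one of the form \<open>(x, \<xi> t)\<close>
  everywhere.\<close>

lemma geodesic_cong:
  assumes "geodesic A A' N c \<gamma>" "\<And>t. t \<in> {0..1} \<Longrightarrow> \<gamma>' t = \<gamma> t"
  shows "geodesic A A' N c \<gamma>'"
proof -
  have "path \<gamma>'"
    using assms unfolding geodesic_def path_def by (metis (no_types, lifting) continuous_on_cong)
  moreover have "\<forall>t\<in>{0<..<1}. \<gamma>' t \<in> N"
    using assms by (simp add: geodesic_def)
  moreover have
    "geodesic_equation_at (cost_metric c U \<phi> V \<psi>) (\<lambda>s. \<phi> (fst (\<gamma>' s)) \<oplus>\<^sub>v \<psi> (snd (\<gamma>' s))) t"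
    if "t \<in> {0..1}" "\<gamma>' t \<in> N" "(U, \<phi>) \<in> A" "(V, \<psi>) \<in> A'" "\<gamma>' t \<in> U \<times> V" for t U \<phi> V \<psi>
  proof (rule geodesic_equation_at_cong[OF _ _ that(1)])
    show "geodesic_equation_at (cost_metric c U \<phi> V \<psi>) (\<lambda>s. \<phi> (fst (\<gamma> s)) \<oplus>\<^sub>v \<psi> (snd (\<gamma> s))) t"
      using assms that unfolding geodesic_def by fastforce
  qed (simp add: assms(2))
  ultimately show ?thesis unfolding geodesic_def by auto
qed

text \<open>Transfers the contact inequality from an end of the geodesic to an interior point.
  Infinite values are allowed for \<open>p\<close>, \<open>q\<close> and \<open>q'\<close>, so terms
  cannot simply be moved across.\<close>

lemma ereal_add_le_via_diff:
  fixes a b b' p q q' :: ereal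
  assumes "\<bar>a\<bar> \<noteq> \<infinity>" "\<bar>b\<bar> \<noteq> \<infinity>" "\<bar>b'\<bar> \<noteq> \<infinity>" "p \<noteq> - \<infinity>" "q \<noteq> - \<infinity>"
    and "b - q \<le> b' - q'" "a + b' \<le> p + q'"
  shows "a + b \<le> p + q"
proof -
  obtain a1 b1 b1' where "a = ereal a1" "b = ereal b1" "b' = ereal b1'"
    using assms(1-3) by (metis ereal_real)
  then show ?thesis using assms(4-7) by (cases p q q' rule: ereal3_cases) auto
qed

theorem theorem3p1:
  fixes M :: "'a::{metric_space, second_countable_topology} set"
    and M' :: "'b::{metric_space, second_countable_topology} set"
    and A :: "('a set \<times> ('a \<Rightarrow> real^'n)) set"
    and A' :: "('b set \<times> ('b \<Rightarrow> real^'n)) set"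
    and N :: "('a \<times> 'b) set"
    and c :: "'a \<times> 'b \<Rightarrow> ereal"
    and \<Omega> :: "'a set" and \<Omega>' :: "'b set" and x :: 'a and u :: "'a \<Rightarrow> ereal"
  assumes "smooth_atlas M A" and "compact (closure M)"
    and "smooth_atlas M' A'" and "compact (closure M')"
    and "openin (top_of_set (M \<times> M')) N"
    and "\<forall>z\<in>closure (M \<times> M'). c z \<noteq> -\<infinity>"
    and "lower_semicontinuous_on (closure (M \<times> M')) c"
    and "cost_Ck 4 A A' N c" and "nondegenerate A A' N c"
    and "horizontally_convex A M' A' N c"
    and "\<Omega> \<subseteq> closure M" and "x \<in> M"
    and "\<Omega>' \<subseteq> closure (section_right N x)"
    and "appears_convex_right A A' N c \<Omega>' x"
    and "\<forall>\<xi>. geodesic A A' N c (\<lambda>t. (x, \<xi> t)) \<and> (\<forall>t\<in>{0..1}. \<xi> t \<in> \<Omega>') \<longrightarrow>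
           \<Omega> \<subseteq> closure (\<Inter>t\<in>{0..1}. section_left N (\<xi> t))"
    and "continuous_on (closure N) c"
    and "weakly_regular A A' N c"
    and "\<forall>y\<in>\<Omega>. u y \<noteq> -\<infinity>"
    and "x \<in> {y \<in> \<Omega>. u y < \<infinity>}"
  shows "connected (\<Omega>' \<inter> c_subdifferential_at M M' c \<Omega> u x) \<and>
         appears_convex_right A A' N c (\<Omega>' \<inter> c_subdifferential_at M M' c \<Omega> u x) x"
proof -
  interpret cost_geometry M A M' A' N c
    using assms by unfold_locales auto
  define S where "S = \<Omega>' \<inter> c_subdifferential_at M M' c \<Omega> u x"
  have cl_N: "closure N \<subseteq> closure (M \<times> M')" by (rule closure_mono[OF N_subset])
  have c_ninf: "c p \<noteq> - \<infinity>" if "p \<in> closure N" for p using assms(6) cl_N that by blast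
  have x\<Omega>: "x \<in> \<Omega>" "\<bar>u x\<bar> \<noteq> \<infinity>" using assms(18,19) by auto
  have \<Omega>'_cl: "{x} \<times> \<Omega>' \<subseteq> closure N"
    using assms(14) by (simp add: appears_convex_right_def geodesically_convex_def)
  \<comment> \<open>Both conclusions are read off from this: the curves witness geodesic convexity
    and serve as paths.\<close>
  have link: "\<exists>\<xi>. geodesic A A' N c (\<lambda>t. (x, \<xi> t)) \<and> \<xi> 0 = z0 \<and> \<xi> 1 = z1 \<and> (\<forall>t\<in>{0..1}. \<xi> t \<in> S)"
    if z: "z0 \<in> S" "z1 \<in> S" "z0 \<noteq> z1" for z0 z1
  proof -
    obtain \<gamma> where \<gamma>: "geodesic A A' N c \<gamma>" "pathstart \<gamma> = (x, z0)" "pathfinish \<gamma> = (x, z1)"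
      "path_image \<gamma> \<subseteq> {x} \<times> \<Omega>'"
      using assms(14) z unfolding appears_convex_right_def geodesically_convex_def S_def
      by (metis IntD1 SigmaI prod.inject singletonI)
    define \<xi> where "\<xi> t = snd (\<gamma> t)" for t
    have \<gamma>_eq: "\<gamma> t = (x, \<xi> t)" and \<xi>\<Omega>': "\<xi> t \<in> \<Omega>'" if "t \<in> {0..1}" for t
    proof -
      have "\<gamma> t \<in> {x} \<times> \<Omega>'" using \<gamma>(4) that unfolding path_image_def by blast
      then show "\<gamma> t = (x, \<xi> t)" "\<xi> t \<in> \<Omega>'" by (auto simp: \<xi>_def)
    qed
    have \<xi>01: "\<xi> 0 = z0" "\<xi> 1 = z1" using \<gamma>(2,3) by (auto simp: \<xi>_def pathstart_def pathfinish_def)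
    have geo: "geodesic A A' N c (\<lambda>t. (x, \<xi> t))" by (rule geodesic_cong[OF \<gamma>(1)]) (simp add: \<gamma>_eq)
    interpret sliding_mountain M A M' A' N c x \<xi>
      using assms(10) geo by unfold_locales
    have x_cl: "(x, \<xi> t) \<in> closure N" if "t \<in> {0..1}" for t using \<xi>\<Omega>'[OF that] \<Omega>'_cl by blast
    have fin_N: "\<bar>c p\<bar> \<noteq> \<infinity>" if "p \<in> N" for p
      using assms(8) that by (simp add: cost_Ck_def)
    \<comment> \<open>Interior points lie in \<open>N\<close>; the two ends lie in the contact set
      and hence in the domain of the cost.\<close>
    have fin: "\<bar>c (x, \<xi> t)\<bar> \<noteq> \<infinity>" if t: "t \<in> {0..1}" for t
    proof (cases "t \<in> {0<..<1}")
      case True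
      then show ?thesis by (intro fin_N x_\<xi>_in_N)
    next
      case False
      then have "\<xi> t \<in> S" using t z(1,2) \<xi>01 by (cases "t = 0") auto
      then have "c (x, \<xi> t) < \<infinity>"
        by (auto simp: S_def c_subdifferential_at_def c_subdifferential_def Dom_cost_def)
      then show ?thesis using c_ninf[OF x_cl[OF t]] by auto
    qed
    \<comment> \<open>The points that see the whole curve inside \<open>N\<close>, where the
      mountain inequality is available; by hypothesis they are dense in
      \<open>\<Omega>\<close>.\<close>
    define D where "D = (\<Inter>t\<in>{0..1}. section_left N (\<xi> t))"
    have \<Omega>D: "\<Omega> \<subseteq> closure D" using assms(15) geo \<xi>\<Omega>' unfolding D_def by blast
    have D_N: "(y, \<xi> t) \<in> N" if "y \<in> D" "t \<in> {0..1}" for y t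
      using that by (auto simp: D_def section_left_def)
    have y_cl: "(y, \<xi> t) \<in> closure N"
      and mountain:
        "c (x, \<xi> t) - c (y, \<xi> t) \<le> max (c (x, \<xi> 0) - c (y, \<xi> 0)) (c (x, \<xi> 1) - c (y, \<xi> 1))"
      if y: "y \<in> \<Omega>" and t: "t \<in> {0..1}" for y t
    proof -
      obtain Y where Y: "\<And>k. Y k \<in> D" "Y \<longlonglongrightarrow> y"
        using \<Omega>D y closure_sequential by blast
      have lim: "(\<lambda>k. (Y k, \<xi> s)) \<longlonglongrightarrow> (y, \<xi> s)" for s by (intro tendsto_intros Y(2))
      have cl: "(y, \<xi> s) \<in> closure N" if "s \<in> {0..1}" for s
        using lim[of s] D_N[OF Y(1) that] unfolding closure_sequential
        by (intro exI[of _ "\<lambda>k. (Y k, \<xi> s)"]) simp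
      show "(y, \<xi> t) \<in> closure N" by (rule cl[OF t])
      have G: "(\<lambda>k. c (x, \<xi> s) - c (Y k, \<xi> s)) \<longlonglongrightarrow> c (x, \<xi> s) - c (y, \<xi> s)" if s: "s \<in> {0..1}" for s
      proof -
        have "(\<lambda>k. c (Y k, \<xi> s)) \<longlonglongrightarrow> c (y, \<xi> s)"
          using D_N[OF Y(1) s] closure_subset
          by (intro continuous_on_tendsto_compose[OF assms(16) lim cl[OF s]])
            (auto intro!: always_eventually)
        \<comment> \<open>The limit \<open>c (y, \<xi> s)\<close> may be infinite. Writing the
          difference as a negated sum with a finite constant makes the limit law for sums
          applicable.\<close>
        then have "(\<lambda>k. - (c (Y k, \<xi> s) + - c (x, \<xi> s))) \<longlonglongrightarrow> - (c (y, \<xi> s) + - c (x, \<xi> s))"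
          using fin[OF s] c_ninf[OF cl[OF s]]
          by (intro tendsto_uminus_ereal tendsto_add_ereal_nonneg tendsto_const) auto
        moreover have "- (v + - c (x, \<xi> s)) = c (x, \<xi> s) - v" for v
          using fin[OF s] by (cases v; cases "c (x, \<xi> s)") auto
        ultimately show ?thesis by simp
      qed
      show "c (x, \<xi> t) - c (y, \<xi> t) \<le> max (c (x, \<xi> 0) - c (y, \<xi> 0)) (c (x, \<xi> 1) - c (y, \<xi> 1))"
      proof (rule LIMSEQ_le[OF G[OF t] tendsto_max[OF G G]])
        have "c (x, \<xi> t) - c (Y k, \<xi> t) \<le> max (c (x, \<xi> 0) - c (Y k, \<xi> 0))
          (c (x, \<xi> 1) - c (Y k, \<xi> 1))" for k
        proof -
          have eq: "c (x, \<xi> s) - c (Y k, \<xi> s) = ereal (F x s - F (Y k) s)" if "s \<in> {0..1}" for s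
            unfolding F_def using fin[OF that] fin_N[OF D_N[OF Y(1)[of k] that]]
            by (metis ereal_minus(1) ereal_real)
          show ?thesis
            using double_mountain_above_sliding_mountain[OF D_N[OF Y(1)] fin assms(16) t, of k]
            by (simp add: eq[OF t] eq ereal_max[symmetric] del: ereal_max)
        qed
        then show "\<exists>n. \<forall>k\<ge>n. c (x, \<xi> t) - c (Y k, \<xi> t)
          \<le> max (c (x, \<xi> 0) - c (Y k, \<xi> 0)) (c (x, \<xi> 1) - c (Y k, \<xi> 1))"
          by blast
      qed auto
    qed
    have "\<xi> t \<in> S" if t: "t \<in> {0..1}" for t
    proof -
      have ends: "u y + c (y, \<xi> s) \<ge> u x + c (x, \<xi> s)" if "y \<in> \<Omega>" "s = 0 \<or> s = 1" for y s
      proof -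
        have "\<xi> s \<in> S" using that(2) z(1,2) \<xi>01 by auto
        then show ?thesis using that(1)
          by (auto simp: S_def c_subdifferential_at_def c_subdifferential_def)
      qed
      have "u y + c (y, \<xi> t) \<ge> u x + c (x, \<xi> t)" if y: "y \<in> \<Omega>" for y
      proof -
        have u_y: "u y \<noteq> - \<infinity>" using assms(18) y by blast
        \<comment> \<open>The larger end dominates, and the contact inequality at that end yields
          the one at \<open>t\<close>.\<close>
        consider "c (x, \<xi> t) - c (y, \<xi> t) \<le> c (x, \<xi> 0) - c (y, \<xi> 0)"
          | "c (x, \<xi> t) - c (y, \<xi> t) \<le> c (x, \<xi> 1) - c (y, \<xi> 1)"
          using mountain[OF y t] by (auto simp: le_max_iff_disj)
        then show ?thesis
        proof cases
          case 1
          from ereal_add_le_via_diff[OF x\<Omega>(2) fin[OF t] fin u_y c_ninf[OF y_cl[OF y t]] this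
            ends[OF y]]
          show ?thesis by simp
        next
          case 2
          from ereal_add_le_via_diff[OF x\<Omega>(2) fin[OF t] fin u_y c_ninf[OF y_cl[OF y t]] this
            ends[OF y]]
          show ?thesis by simp
        qed
      qed
      moreover have "(x, \<xi> t) \<in> closure (M \<times> M')" using x_cl[OF t] cl_N by blast
      ultimately show ?thesis
        using \<xi>\<Omega>'[OF t] x\<Omega>(1) fin[OF t]
        by (auto simp: S_def c_subdifferential_at_def c_subdifferential_def Dom_cost_def
          closure_Times less_top)
    qed
    then show ?thesis using geo \<xi>01 by blast
  qed
  have "path_connected S"
    unfolding path_connected_def
  proof (intro ballI)
    fix z0 z1 assume z: "z0 \<in> S" "z1 \<in> S"
    show "\<exists>p. path p \<and> path_image p \<subseteq> S \<and> pathstart p = z0 \<and> pathfinish p = z1"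
    proof (cases "z0 = z1")
      case True
      then show ?thesis using z by (intro exI[of _ "\<lambda>_. z0"])
        (auto simp: path_def path_image_def pathstart_def pathfinish_def)
    next
      case False
      then obtain \<xi> where \<xi>: "geodesic A A' N c (\<lambda>t. (x, \<xi> t))" "\<xi> 0 = z0" "\<xi> 1 = z1"
        "\<forall>t\<in>{0..1}. \<xi> t \<in> S"
        using link z by blast
      have "path \<xi>"
        using continuous_on_snd[of "{0..1}" "\<lambda>t. (x, \<xi> t)"] \<xi>(1)
          by (simp add: geodesic_def path_def)
      with \<xi> show ?thesis
        by (intro exI[of _ \<xi>]) (auto simp: path_image_def pathstart_def pathfinish_def)
    qed
  qed
  moreover have "geodesically_convex A A' N c ({x} \<times> S)"
    unfolding geodesically_convex_def
  proof (intro conjI ballI impI)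
    show "{x} \<times> S \<subseteq> closure N" using \<Omega>'_cl by (auto simp: S_def)
    fix p q assume "p \<in> {x} \<times> S" "q \<in> {x} \<times> S" "p \<noteq> q"
    then obtain z0 z1 where z: "p = (x, z0)" "q = (x, z1)" "z0 \<in> S" "z1 \<in> S" "z0 \<noteq> z1" by auto
    from link[OF z(3-5)] obtain \<xi>
      where "geodesic A A' N c (\<lambda>t. (x, \<xi> t))" "\<xi> 0 = z0" "\<xi> 1 = z1" "\<forall>t\<in>{0..1}. \<xi> t \<in> S"
      by blast
    then show "\<exists>\<gamma>. geodesic A A' N c \<gamma> \<and> pathstart \<gamma> = p \<and> pathfinish \<gamma> = q
      \<and> path_image \<gamma> \<subseteq> {x} \<times> S"
      using z by (intro exI[of _ "\<lambda>t. (x, \<xi> t)"])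
        (auto simp: path_image_def pathstart_def pathfinish_def)
  qed
  ultimately show ?thesis
    using assms(13) path_connected_imp_connected unfolding appears_convex_right_def S_def by blast
qed

end
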